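(* Let $\Omega\subset\mathbb{R}^n$ be open and convex, let $0<s<1/n$, let $\mu$ be an $s$-concave measure on $\Omega$ with density $f$, and let $K$ be a $p$-convex body contained in $\Omega$, for some $p\in(0,1]$. If $k\ge1$ is a real number, then the body $L$ whose Minkowski functional is given by $$\|x\|_L=\left[\int_0^\infty 1_K(rx)f(rx)\,r^{k-1}\,dr\right]^{-\frac1k},\qquad x\in\mathbb{R}^n,$$ is $q$-convex, that is, $\|x+y\|_L^q\le\|x\|_L^q+\|y\|_L^q$ for all $x,y\in\mathbb{R}^n$, with $$q=\left[\left(\frac1p-1\right)\left(\frac1s-n\right)\frac1k+\frac1p\right]^{-1}.$$
   Context: A body is a compact set with nonempty interior. For a body $K\subset\mathbb{R}^n$ that is star-shaped with respect to the origin (in particular $0\in K$), its Minkowski functional is $\|x\|_K=\min\{\lambda\ge0:x\in\lambda K\}$, with value $+\infty$ if no such $\lambda$ exists. $K$ is not assumed symmetric, and the origin may lie on the boundary of $K$. For $p\in(0,1]$, such a body $K$ is $p$-convex if $\|x+y\|_K^p\le\|x\|_K^p+\|y\|_K^p$ for all $x,y\in\mathbb{R}^n$; equivalently, $t^{1/p}x+(1-t)^{1/p}y\in K$ whenever $x,y\in K$ and $t\in(0,1)$. $1_K$ denotes the indicator function of $K$, and $1_K(rx)f(rx)$ is taken to be $0$ when $rx\notin K$. A Radon measure $\mu$ on an open convex set $\Omega\subset\mathbb{R}^n$ is $s$-concave ($s>0$) if $\mu(\lambda A+(1-\lambda)B)\ge[\lambda\mu(A)^s+(1-\lambda)\mu(B)^s]^{1/s}$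 for all nonempty compact $A,B\subset\Omega$ and all $\lambda\in(0,1)$. By a theorem of Borell, for $0<s<1/n$, $\mu$ is $s$-concave if and only if the support of $\mu$ is $n$-dimensional and $d\mu=f\,dm$ ($m$ Lebesgue measure) for some nonnegative $f\in L^1_{loc}(\Omega)$ such that $f^{\frac{s}{1-ns}}$ is a concave function on $\Omega$; the density $f$ in the claim is this one. Conventions: in the formula for $\|x\|_L$, $0^{-1/k}=+\infty$, and $\|0\|_L=0$; the inequality for $\|\cdot\|_L$ is understood in $[0,\infty]$. *)

theory Defs
  imports "HOL-Analysis.Analysis"
begin

definition body :: "'a::euclidean_space set \<Rightarrow> bool" where
  "body K \<longleftrightarrow> compact K \<and> interior K \<noteq> {}"

text \<open>The library's \<^const>\<open>starlike\<close> leaves the centre unspecified; here it has to be the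
  origin, which may be a boundary point of the set.\<close>

definition star_shaped :: "'a::euclidean_space set \<Rightarrow> bool" where
  "star_shaped K \<longleftrightarrow> 0 \<in> K \<and> (\<forall>x\<in>K. closed_segment 0 x \<subseteq> K)"

text \<open>Since \<^term>\<open>Inf {} = (\<infinity>::ennreal)\<close>, the value is infinite when no admissible dilation
  exists; for compact \<^term>\<open>K\<close> the infimum is otherwise attained.\<close>

definition minkowski :: "'a::euclidean_space set \<Rightarrow> 'a \<Rightarrow> ennreal" where
  "minkowski K x = Inf {ennreal l | l. 0 \<le> l \<and> x \<in> (\<lambda>y. l *\<^sub>R y) ` K}"

text \<open>Real powers on \<open>[0,\<infinity>]\<close>, with \<open>0\<close> and \<open>\<infinity>\<close> exchanged by negative exponents.
  For \<^term>\<open>a > 0\<close> the last branch also covers \<open>x = 0\<close>, as \<open>0 powr a = 0\<close>.\<close>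

definition epowr :: "ennreal \<Rightarrow> real \<Rightarrow> ennreal" where
  "epowr x a =
    (if a = 0 then 1
     else if x = \<infinity> then (if a > 0 then \<infinity> else 0)
     else if x = 0 \<and> a < 0 then \<infinity>
     else ennreal (enn2real x powr a))"

definition p_convex_body :: "real \<Rightarrow> 'a::euclidean_space set \<Rightarrow> bool" where
  "p_convex_body p K \<longleftrightarrow>
     0 < p \<and> p \<le> 1 \<and> body K \<and> star_shaped K \<and>
     (\<forall>x y. epowr (minkowski K (x + y)) p
            \<le> epowr (minkowski K x) p + epowr (minkowski K y) p)"

definition radon_measure_on :: "'a::euclidean_space set \<Rightarrow> 'a measure \<Rightarrow> bool" where
  "radon_measure_on \<Omega> \<mu> \<longleftrightarrow>
     sets \<mu> = sets (restrict_space borel \<Omega>) \<and>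
     (\<forall>C. compact C \<and> C \<subseteq> \<Omega> \<longrightarrow> emeasure \<mu> C < \<infinity>) \<and>
     (\<forall>A\<in>sets \<mu>. emeasure \<mu> A = (SUP C\<in>{C. compact C \<and> C \<subseteq> A}. emeasure \<mu> C))"

text \<open>All three sets below are compact subsets of the convex set \<open>\<Omega>\<close>, so their measures are
  finite and the real-valued \<^const>\<open>measure\<close> loses nothing.\<close>

definition s_concave_measure :: "real \<Rightarrow> 'a::euclidean_space set \<Rightarrow> 'a measure \<Rightarrow> bool" where
  "s_concave_measure s \<Omega> \<mu> \<longleftrightarrow>
     radon_measure_on \<Omega> \<mu> \<and>
     (\<forall>A B t. compact A \<and> A \<noteq> {} \<and> A \<subseteq> \<Omega> \<and> compact B \<and> B \<noteq> {} \<and> B \<subseteq> \<Omega> \<and> 0 < t \<and> t < 1 \<longrightarrow>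
        measure \<mu> {t *\<^sub>R a + (1 - t) *\<^sub>R b | a b. a \<in> A \<and> b \<in> B}
        \<ge> (t * measure \<mu> A powr s + (1 - t) * measure \<mu> B powr s) powr (1 / s))"

definition measure_support :: "'a::euclidean_space set \<Rightarrow> 'a measure \<Rightarrow> 'a set" where
  "measure_support \<Omega> \<mu> = {x\<in>\<Omega>. \<forall>U. open U \<and> x \<in> U \<longrightarrow> emeasure \<mu> (U \<inter> \<Omega>) > 0}"

text \<open>The density that Borell's theorem attaches to an \<open>s\<close>-concave measure, \<open>0 < s < 1/n\<close>.
  The concavity condition singles out one representative of the almost-everywhere class,
  which matters because the density is later integrated along rays. Full-dimensionality
  of the support excludes the zero measure. The values of \<open>f\<close> off \<open>\<Omega>\<close> are irrelevant.\<close>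

definition borell_density ::
    "real \<Rightarrow> 'a::euclidean_space set \<Rightarrow> 'a measure \<Rightarrow> ('a \<Rightarrow> real) \<Rightarrow> bool" where
  "borell_density s \<Omega> \<mu> f \<longleftrightarrow>
     aff_dim (measure_support \<Omega> \<mu>) = int DIM('a) \<and>
     (\<forall>x\<in>\<Omega>. 0 \<le> f x) \<and>
     (\<forall>C. compact C \<and> C \<subseteq> \<Omega> \<longrightarrow> set_integrable lborel C f) \<and>
     \<mu> = density (restrict_space lborel \<Omega>) (\<lambda>x. ennreal (f x)) \<and>
     concave_on \<Omega> (\<lambda>x. f x powr (s / (1 - real DIM('a) * s)))"

definition radial_functional ::
    "'a::euclidean_space set \<Rightarrow> ('a \<Rightarrow> real) \<Rightarrow> real \<Rightarrow> 'a \<Rightarrow> ennreal" where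
  "radial_functional K f k x =
     (if x = 0 then 0
      else epowr (\<integral>\<^sup>+ r\<in>{0<..}. (indicator K (r *\<^sub>R x) * ennreal (f (r *\<^sub>R x)) * ennreal (r powr (k - 1)))
                    \<partial>lborel) (- (1 / k)))"

end

theory Submission
  imports Defs
begin

text \<open>
  Write \<open>f = g powr \<alpha>\<close> with \<open>\<alpha> = 1/s - n\<close> and \<open>g\<close> concave and positive, \<open>I(x)\<close> for the integral
  defining \<open>\<parallel>x\<parallel>\<^sub>L powr (- k)\<close>, and \<open>m = k/q\<close>. The claim is
  \<open>I(x + y) powr (- 1/m) \<le> I(x) powr (- 1/m) + I(y) powr (- 1/m)\<close>.

  Let \<open>r(\<tau>)\<close> and \<open>t(\<tau>)\<close> cut off the fraction \<open>\<tau>\<close> of the masses \<open>I(x)\<close> and \<open>I(y)\<close>, and let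
  \<open>u powr (- p) = r powr (- p) + t powr (- p)\<close>. By \<open>p\<close>-convexity \<open>u (x + y)\<close> lies in \<open>K\<close>, and with
  \<open>\<lambda> = (u/r) powr p\<close> the concavity of \<open>g\<close> (discarding the nonnegative term at the origin) yields
  \<open>g (u (x + y)) \<ge> \<lambda> H1 + (1 - \<lambda>) H2\<close>, where \<open>H1 = \<lambda> powr (1/p - 1) * g (r x)\<close> and similarly \<open>H2\<close>.
  Since \<open>r'(\<tau>)\<close> and \<open>t'(\<tau>)\<close> are the reciprocals of the normalised densities, the mass of the ray
  through \<open>x + y\<close> grows in \<open>\<tau>\<close> at least at the rate
  \<open>(\<lambda> H1 + (1 - \<lambda>) H2) powr \<alpha> *
     (\<lambda> (\<lambda> powr m) I(x) H1 powr (- \<alpha>) + (1 - \<lambda>) ((1 - \<lambda>) powr m) I(y) H2 powr (- \<alpha>))\<close>.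
  Three applications of the weighted AM-GM inequality eliminate \<open>H1\<close>, \<open>H2\<close> and \<open>\<lambda>\<close> and bound this
  below by \<open>(I(x) powr (- 1/m) + I(y) powr (- 1/m)) powr (- m)\<close>.
\<close>

subsection \<open>Transport along rays\<close>

lemma ln_weighted_ge:
  fixes a b l1 l2 :: real
  assumes "0 < a" "0 < b" "0 < l1" "0 < l2" "l1 + l2 = 1"
  shows "l1 * ln a + l2 * ln b \<le> ln (l1 * a + l2 * b)"
  using concave_onD[OF ln_concave, of l2 a b] assms by (simp add: add.commute flip: eq_diff_eq)

text \<open>Take logarithms. The first factor yields at least \<open>\<alpha>\<close> times the
  weighted mean of \<open>ln H1\<close> and \<open>ln H2\<close>, which cancels the contribution of
  the powers \<open>- \<alpha>\<close> inside \<open>?S\<close>. What remains is an entropy-like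
  term in \<open>l1\<close>, \<open>l2\<close>, bounded by a third use of concavity of
  \<open>ln\<close>.\<close>

lemma transport_integrand_ge:
  fixes l1 l2 H1 H2 I1 I2 \<alpha> m :: real
  assumes l: "0 < l1" "0 < l2" "l1 + l2 = 1" and H: "0 < H1" "0 < H2" and I: "0 < I1" "0 < I2"
    and \<alpha>: "0 < \<alpha>" and m: "0 < m"
  shows "(I1 powr (- 1 / m) + I2 powr (- 1 / m)) powr (- m)
    \<le> (l1 * H1 + l2 * H2) powr \<alpha> *
      (l1 * (l1 powr m * I1 * H1 powr - \<alpha>) + l2 * (l2 powr m * I2 * H2 powr - \<alpha>))"
    (is "?M \<le> ?h powr \<alpha> * ?S")
proof -
  have pos: "0 < ?h" "0 < ?S" "0 < I1 powr (- 1 / m) + I2 powr (- 1 / m)"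
    using assms by (auto intro!: add_pos_pos mult_pos_pos)
  \<comment> \<open>Dividing by the weights makes the weighted mean collapse to the plain sum and
    produces the terms \<open>m * ln l1\<close> and \<open>m * ln l2\<close> that also occur in
    \<open>ln ?S\<close>.\<close>
  have "l1 * ln (I1 powr (- 1 / m) / l1) + l2 * ln (I2 powr (- 1 / m) / l2)
      \<le> ln (l1 * (I1 powr (- 1 / m) / l1) + l2 * (I2 powr (- 1 / m) / l2))"
    using assms by (intro ln_weighted_ge) auto
  also have "\<dots> = ln (I1 powr (- 1 / m) + I2 powr (- 1 / m))"
    using l by simp
  finally have "m * (l1 * ln (I1 powr (- 1 / m) / l1) + l2 * ln (I2 powr (- 1 / m) / l2))
      \<le> m * ln (I1 powr (- 1 / m) + I2 powr (- 1 / m))"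
    using m by (intro mult_left_mono) auto
  moreover have "m * ln (c powr (- 1 / m) / d) = - (m * ln d + ln c)" if "0 < c" "0 < d" for c d
    using that m by (simp add: ln_div field_simps)
  then have "m * (l1 * ln (I1 powr (- 1 / m) / l1) + l2 * ln (I2 powr (- 1 / m) / l2))
      = l1 * - (m * ln l1 + ln I1) + l2 * - (m * ln l2 + ln I2)"
    using l I by (simp only: distrib_left mult.left_commute[of m])
  ultimately have A: "- m * ln (I1 powr (- 1 / m) + I2 powr (- 1 / m))
      \<le> l1 * (m * ln l1 + ln I1) + l2 * (m * ln l2 + ln I2)"
    by linarith
  have B: "l1 * ln H1 + l2 * ln H2 \<le> ln ?h"
    using assms by (intro ln_weighted_ge) auto
  have "l1 * ln (l1 powr m * I1 * H1 powr - \<alpha>) + l2 * ln (l2 powr m * I2 * H2 powr - \<alpha>) \<le> ln ?S"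
    using assms by (intro ln_weighted_ge) auto
  then have C: "l1 * (m * ln l1 + ln I1 - \<alpha> * ln H1) + l2 * (m * ln l2 + ln I2 - \<alpha> * ln H2) \<le> ln ?S"
    using assms by (simp add: ln_mult ln_powr)
  have "\<alpha> * (l1 * ln H1 + l2 * ln H2) \<le> \<alpha> * ln ?h"
    using B \<alpha> by (intro mult_left_mono) auto
  with A C have "- m * ln (I1 powr (- 1 / m) + I2 powr (- 1 / m)) \<le> \<alpha> * ln ?h + ln ?S"
    by (simp add: algebra_simps)
  also have "\<dots> = ln (?h powr \<alpha> * ?S)"
    using pos by (simp add: ln_mult ln_powr)
  finally have "ln ?M \<le> ln (?h powr \<alpha> * ?S)"
    using pos by (simp add: ln_powr)
  moreover have "0 < ?M" "0 < ?h powr \<alpha> * ?S"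
    using pos by auto
  ultimately show ?thesis by (simp only: ln_le_cancel_iff)
qed

text \<open>\<open>\<rho> \<tau>\<close> is the radius below which the fraction
  \<open>\<tau>\<close> of the total mass \<open>J\<close> lies, so its derivative comes from the
  inverse function rule. Positivity of \<open>F\<close> is asked for \<open>r > 0\<close> only,
  because the intended weight \<open>r powr (k - 1)\<close> vanishes at 0 when
  \<open>k > 1\<close>.\<close>

lemma integral_inverse_param:
  fixes F :: "real \<Rightarrow> real"
  assumes R: "0 < R" and cont: "continuous_on {0..R} F"
    and pos: "\<And>r. 0 < r \<Longrightarrow> r \<le> R \<Longrightarrow> 0 < F r"
  defines "J \<equiv> integral {0..R} F"
  shows "0 < J"
    and "\<exists>\<rho>. \<forall>\<tau>. 0 < \<tau> \<and> \<tau> < 1 \<longrightarrow>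
      0 < \<rho> \<tau> \<and> \<rho> \<tau> < R \<and> (\<rho> has_real_derivative J / F (\<rho> \<tau>)) (at \<tau>)"
proof -
  define \<Psi> where "\<Psi> = (\<lambda>x. integral {0..x} F)"
  have int: "F integrable_on {0..x}" if "x \<le> R" for x
    by (rule integrable_continuous_real, rule continuous_on_subset[OF cont]) (use that in auto)
  have cont\<Psi>: "continuous_on {0..R} \<Psi>"
    unfolding \<Psi>_def by (rule indefinite_integral_continuous_1) (use int R in auto)
  have deriv: "(\<Psi> has_real_derivative F x) (at x)" if "0 < x" "x < R" for x
  proof -
    have "(\<Psi> has_real_derivative F x) (at x within {0..R})"
      unfolding \<Psi>_def by (rule integral_has_real_derivative[OF cont]) (use that in auto)
    then show ?thesis
      using that by (simp add: at_within_Icc_at)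
  qed
  have mono: "\<Psi> a < \<Psi> b" if "0 \<le> a" "a < b" "b \<le> R" for a b
  proof (rule DERIV_pos_imp_increasing_open[OF that(2)])
    fix x assume "a < x" "x < b"
    then show "\<exists>y. DERIV \<Psi> x :> y \<and> 0 < y"
      using deriv[of x] pos[of x] that by auto
  qed (rule continuous_on_subset[OF cont\<Psi>], use that in auto)
  have \<Psi>0: "\<Psi> 0 = 0" and \<Psi>R: "\<Psi> R = J"
    by (auto simp: \<Psi>_def J_def)
  show J: "0 < J" using mono[of 0 R] R \<Psi>0 \<Psi>R by simp
  have inj: "inj_on \<Psi> {0..R}"
  proof (rule inj_onI)
    fix a b assume "a \<in> {0..R}" "b \<in> {0..R}" "\<Psi> a = \<Psi> b"
    then show "a = b"
      using mono[of a b] mono[of b a] by (cases a b rule: linorder_cases) auto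
  qed
  define g where "g = inv_into {0..R} \<Psi>"
  have surj: "\<Psi> ` {0..R} = {0..J}"
  proof
    show "\<Psi> ` {0..R} \<subseteq> {0..J}"
    proof safe
      fix x assume x: "x \<in> {0..R}"
      show "\<Psi> x \<in> {0..J}"
        using mono[of 0 x] mono[of x R] x \<Psi>0 \<Psi>R by (cases "x = 0"; cases "x = R") auto
    qed
    show "{0..J} \<subseteq> \<Psi> ` {0..R}"
    proof
      fix y assume "y \<in> {0..J}"
      then show "y \<in> \<Psi> ` {0..R}"
        using IVT'[of \<Psi> 0 y R] \<Psi>0 \<Psi>R R cont\<Psi> by auto
    qed
  qed
  have contg: "continuous_on {0..J} g"
    using continuous_on_inv[OF cont\<Psi>, of g] surj inj by (simp add: g_def)
  have \<Psi>g: "\<Psi> (g y) = y" "g y \<in> {0..R}" if "0 \<le> y" "y \<le> J" for y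
  proof -
    have "y \<in> \<Psi> ` {0..R}" using that surj by simp
    then show "\<Psi> (g y) = y" "g y \<in> {0..R}"
      unfolding g_def by (rule f_inv_into_f, rule inv_into_into)
  qed
  have gr: "0 < g y \<and> g y < R" if "0 < y" "y < J" for y
    using \<Psi>g[of y] that \<Psi>0 \<Psi>R by (cases "g y = 0"; cases "g y = R") auto
  have dg: "(g has_real_derivative inverse (F (g y))) (at y)" if y: "0 < y" "y < J" for y
  proof (rule DERIV_inverse_function[where f = \<Psi> and a = 0 and b = J])
    show "(\<Psi> has_real_derivative F (g y)) (at (g y))"
      using gr[OF y] deriv by blast
    show "F (g y) \<noteq> 0" using gr[OF y] pos[of "g y"] by simp
    show "isCont g y"
      using contg y by (simp add: continuous_on_interior)
  qed (use y \<Psi>g in auto)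
  have "0 < g (\<tau> * J) \<and> g (\<tau> * J) < R \<and>
      ((\<lambda>\<tau>. g (\<tau> * J)) has_real_derivative J / F (g (\<tau> * J))) (at \<tau>)"
    if \<tau>: "0 < \<tau>" "\<tau> < 1" for \<tau>
  proof -
    have y: "0 < \<tau> * J" "\<tau> * J < J" using J \<tau> by auto
    have "((\<lambda>\<tau>. \<tau> * J) has_real_derivative J) (at \<tau>)"
      by (auto intro!: derivative_eq_intros)
    from gr[OF y] DERIV_chain2[OF dg[OF y] this] show ?thesis
      by (simp add: field_simps)
  qed
  then show "\<exists>\<rho>. \<forall>\<tau>. 0 < \<tau> \<and> \<tau> < 1 \<longrightarrow>
      0 < \<rho> \<tau> \<and> \<rho> \<tau> < R \<and> (\<rho> has_real_derivative J / F (\<rho> \<tau>)) (at \<tau>)"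
    by (intro exI[of _ "\<lambda>\<tau>. g (\<tau> * J)"]) blast
qed

section \<open>Combination of radii dictated by the p-triangle inequality\<close>

text \<open>If \<open>r x\<close> and \<open>t y\<close> lie in \<open>K\<close>, the gauges of
  \<open>x\<close> and \<open>y\<close> are at most \<open>1/r\<close> and \<open>1/t\<close>; this
  is the radius along \<open>x + y\<close> that p-convexity then guarantees.\<close>

definition psum :: "real \<Rightarrow> real \<Rightarrow> real \<Rightarrow> real" where
  "psum p r t = (r powr - p + t powr - p) powr (- 1 / p)"

lemma psum_strict_mono:
  assumes "0 < p" "0 < r" "r < r'" "0 < t" "t < t'"
  shows "psum p r t < psum p r' t'"
proof -
  have "r' powr - p < r powr - p" "t' powr - p < t powr - p"
    using assms by (auto intro!: powr_less_mono2_neg)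
  moreover have "0 < r' powr - p + t' powr - p"
    using assms by (auto intro!: add_pos_pos)
  ultimately show ?thesis
    unfolding psum_def using assms by (intro powr_less_mono2_neg) auto
qed

lemma psum_pos:
  assumes "0 < r"
  shows "0 < psum p r t"
proof -
  have "0 < r powr - p + t powr - p"
    using assms by (intro add_pos_nonneg) auto
  then show ?thesis unfolding psum_def by (rule powr_gt_zero[THEN iffD2, OF less_imp_neq[symmetric]])
qed

lemma psum_powr:
  assumes "0 < p" "0 < r"
  shows "psum p r t powr - p = r powr - p + t powr - p"
  using assms by (simp add: psum_def powr_powr add_nonneg_nonneg)

text \<open>The formula is what implicit differentiation of u^(-p) = r^(-p) + t^(-p) gives: u^(-p-1)
  u' = r^(-p-1) r' + t^(-p-1) t'.\<close>

lemma psum_has_derivative: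
  assumes p: "0 < p" and "0 < r \<tau>" "0 < t \<tau>"
    and "(r has_real_derivative r') (at \<tau>)" "(t has_real_derivative t') (at \<tau>)"
  shows "((\<lambda>\<tau>. psum p (r \<tau>) (t \<tau>)) has_real_derivative
    psum p (r \<tau>) (t \<tau>) powr (1 + p) * (r \<tau> powr (- p - 1) * r' + t \<tau> powr (- p - 1) * t')) (at \<tau>)"
proof -
  have s: "0 < r \<tau> powr - p + t \<tau> powr - p" using assms by (auto intro!: add_pos_pos)
  have *: "((\<lambda>\<tau>. r \<tau> powr - p + t \<tau> powr - p) has_real_derivative
    (- p * r \<tau> powr (- p - 1) * r' + - p * t \<tau> powr (- p - 1) * t')) (at \<tau>)"
    using assms by (intro DERIV_add DERIV_chain2[OF has_real_derivative_powr]) auto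
  have D: "((\<lambda>\<tau>. psum p (r \<tau>) (t \<tau>)) has_real_derivative
     (- 1 / p * (r \<tau> powr - p + t \<tau> powr - p) powr (- 1 / p - 1)) *
     (- p * r \<tau> powr (- p - 1) * r' + - p * t \<tau> powr (- p - 1) * t')) (at \<tau>)"
    unfolding psum_def by (rule DERIV_chain2[OF has_real_derivative_powr[OF s] *])
  have E: "(r \<tau> powr - p + t \<tau> powr - p) powr (- 1 / p - 1)
     = psum p (r \<tau>) (t \<tau>) powr (1 + p)"
  proof -
    have "- 1 / p - 1 = - 1 / p * (1 + p)" using p by (simp add: field_simps)
    then show ?thesis by (simp only: psum_def powr_powr)
  qed
  have "- 1 / p * a * (- p * b * r' + - p * c * t') = a * (b * r' + c * t')" for a b c
    using p by (simp add: field_simps)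
  then show ?thesis
    by (rule DERIV_cong[OF D[unfolded E]])
qed

text \<open>Move \<open>r\<close> and \<open>t\<close> so that both have swept the mass fraction
  \<open>\<tau>\<close>. By \<open>ineq\<close>, the mass of \<open>F\<close> up to
  \<open>psum p (r \<tau>) (t \<tau>)\<close> then grows at rate at least \<open>M\<close>, and
  \<open>\<tau>\<close> runs over an interval of length 1.\<close>

lemma integral_ge_of_transport:
  fixes F F1 F2 :: "real \<Rightarrow> real"
  assumes p: "0 < p"
    and R1: "0 < R1" and F1: "continuous_on {0..R1} F1" "\<And>r. 0 < r \<Longrightarrow> r \<le> R1 \<Longrightarrow> 0 < F1 r"
    and R2: "0 < R2" and F2: "continuous_on {0..R2} F2" "\<And>r. 0 < r \<Longrightarrow> r \<le> R2 \<Longrightarrow> 0 < F2 r"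
    and R: "psum p R1 R2 \<le> R" and F: "continuous_on {0..R} F" "\<And>r. 0 \<le> r \<Longrightarrow> r \<le> R \<Longrightarrow> 0 \<le> F r"
    and ineq: "\<And>r t. 0 < r \<Longrightarrow> r \<le> R1 \<Longrightarrow> 0 < t \<Longrightarrow> t \<le> R2 \<Longrightarrow>
      M \<le> F (psum p r t) * (psum p r t powr (1 + p) *
        (r powr (- p - 1) * (integral {0..R1} F1 / F1 r) + t powr (- p - 1) * (integral {0..R2} F2 / F2 t)))"
  shows "M \<le> integral {0..R} F"
proof -
  obtain r where r: "\<And>\<tau>. 0 < \<tau> \<Longrightarrow> \<tau> < 1 \<Longrightarrow> 0 < r \<tau> \<and> r \<tau> < R1"
    "\<And>\<tau>. 0 < \<tau> \<Longrightarrow> \<tau> < 1 \<Longrightarrow> (r has_real_derivative integral {0..R1} F1 / F1 (r \<tau>)) (at \<tau>)"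
    using integral_inverse_param(2)[OF R1 F1] by auto
  obtain t where t: "\<And>\<tau>. 0 < \<tau> \<Longrightarrow> \<tau> < 1 \<Longrightarrow> 0 < t \<tau> \<and> t \<tau> < R2"
    "\<And>\<tau>. 0 < \<tau> \<Longrightarrow> \<tau> < 1 \<Longrightarrow> (t has_real_derivative integral {0..R2} F2 / F2 (t \<tau>)) (at \<tau>)"
    using integral_inverse_param(2)[OF R2 F2] by auto
  define u where "u = (\<lambda>\<tau>. psum p (r \<tau>) (t \<tau>))"
  define G where "G = (\<lambda>\<tau>. integral {0..u \<tau>} F - M * \<tau>)"
  have u: "0 < u \<tau>" "u \<tau> < R" if "0 < \<tau>" "\<tau> < 1" for \<tau>
  proof -
    show "0 < u \<tau>" unfolding u_def using r(1)[OF that] by (intro psum_pos) auto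
    have "u \<tau> < psum p R1 R2"
      unfolding u_def using r(1)[OF that] t(1)[OF that] p by (intro psum_strict_mono) auto
    then show "u \<tau> < R" using R by simp
  qed
  have int: "F integrable_on {0..x}" if "x \<le> R" for x
    by (rule integrable_continuous_real, rule continuous_on_subset[OF F(1)]) (use that in auto)
  have dG: "\<exists>y. DERIV G \<tau> :> y \<and> 0 \<le> y" if \<tau>: "0 < \<tau>" "\<tau> < 1" for \<tau>
  proof -
    let ?d = "u \<tau> powr (1 + p) * (r \<tau> powr (- p - 1) * (integral {0..R1} F1 / F1 (r \<tau>)) +
        t \<tau> powr (- p - 1) * (integral {0..R2} F2 / F2 (t \<tau>)))"
    have du: "(u has_real_derivative ?d) (at \<tau>)"
      unfolding u_def using r[OF \<tau>] t[OF \<tau>] p by (intro psum_has_derivative) auto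
    have "((\<lambda>x. integral {0..x} F) has_real_derivative F (u \<tau>)) (at (u \<tau>))"
      using integral_has_real_derivative[OF F(1), of "u \<tau>"] u[OF \<tau>] by (simp add: at_within_Icc_at)
    from DERIV_diff[OF DERIV_chain2[OF this du] DERIV_cmult_Id[of M]]
    have "(G has_real_derivative F (u \<tau>) * ?d - M) (at \<tau>)"
      unfolding G_def .
    moreover have "M \<le> F (u \<tau>) * ?d"
      unfolding u_def using ineq[of "r \<tau>" "t \<tau>"] r(1)[OF \<tau>] t(1)[OF \<tau>] by auto
    ultimately show ?thesis by (meson diff_ge_0_iff_ge)
  qed
  \<comment> \<open>The parametrisations are controlled on the open interval only, so the
    monotonicity of \<open>G\<close> is used on \<open>[\<epsilon>, 1 - \<epsilon>]\<close> before
    letting \<open>\<epsilon>\<close> tend to 0.\<close>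
  have bound: "M * (1 - \<epsilon>) - M * \<epsilon> \<le> integral {0..R} F" if \<epsilon>: "0 < \<epsilon>" "\<epsilon> < 1 / 2" for \<epsilon>
  proof -
    have "G \<epsilon> \<le> G (1 - \<epsilon>)"
      by (rule DERIV_nonneg_imp_nondecreasing) (use dG \<epsilon> in auto)
    moreover have "0 \<le> integral {0..u \<epsilon>} F"
      using u[of \<epsilon>] F(2) \<epsilon> int by (intro integral_nonneg) auto
    moreover have "integral {0..u (1 - \<epsilon>)} F \<le> integral {0..R} F"
      using u[of "1 - \<epsilon>"] F(2) \<epsilon> int by (intro integral_subset_le) auto
    ultimately show ?thesis by (simp add: G_def)
  qed
  have "((\<lambda>\<epsilon>. M * (1 - \<epsilon>) - M * \<epsilon>) \<longlongrightarrow> M * (1 - 0) - M * 0) (at_right 0)"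
    by (intro tendsto_intros)
  then have "M * (1 - 0) - M * 0 \<le> integral {0..R} F"
  proof (rule tendsto_upperbound)
    show "\<forall>\<^sub>F \<epsilon> in at_right 0. M * (1 - \<epsilon>) - M * \<epsilon> \<le> integral {0..R} F"
      using bound by (auto simp: eventually_at_right_field intro!: exI[of _ "1/2"])
  qed simp
  then show ?thesis by simp
qed

text \<open>Converts one summand of the mass growth rate into the shape required by
  \<open>transport_integrand_ge\<close>, with H = l^(1/p-1) g. The right side depends on
  \<open>u\<close> and \<open>r\<close> through \<open>v = u / r\<close>, and \<open>m\<close> is
  the value for which the exponents agree: p + p m - (1 - p) \<alpha> = k + p.\<close>

lemma transported_term_eq:
  fixes r u J g \<alpha> p k :: real
  assumes "0 < p" "0 < r" "0 < u" "0 < g"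
  defines "l \<equiv> (u / r) powr p" and "m \<equiv> (1 / p - 1) * \<alpha> + k / p"
  shows "u powr (k - 1) * u powr (1 + p) * (r powr (- p - 1) * (J / (g powr \<alpha> * r powr (k - 1))))
    = l * (l powr m * J * (l powr (1 / p - 1) * g) powr - \<alpha>)"
proof -
  define v where "v = u / r"
  have v: "0 < v" using assms by (simp add: v_def)
  have "l * (l powr m * J * (l powr (1 / p - 1) * g) powr - \<alpha>)
      = J * g powr - \<alpha> * (v powr p * v powr (p * m) * v powr (p * (1 / p - 1) * - \<alpha>))"
    using v assms by (simp add: l_def v_def[symmetric] powr_powr powr_mult mult_ac)
  also have "v powr p * v powr (p * m) * v powr (p * (1 / p - 1) * - \<alpha>)
      = v powr (p + p * m + p * (1 / p - 1) * - \<alpha>)"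
    by (simp only: powr_add)
  also have "p + p * m + p * (1 / p - 1) * - \<alpha> = (k - 1) + (1 + p)"
    using assms(1) by (simp add: m_def field_simps)
  also have "v powr ((k - 1) + (1 + p)) = u powr ((k - 1) + (1 + p)) * r powr - ((k - 1) + (1 + p))"
    by (simp only: v_def powr_divide powr_minus_divide times_divide_eq_right mult_1_right)
  also have "u powr ((k - 1) + (1 + p)) = u powr (k - 1) * u powr (1 + p)"
    by (rule powr_add)
  also have "- ((k - 1) + (1 + p)) = (- p - 1) + - (k - 1)"
    by simp
  also have "r powr ((- p - 1) + - (k - 1)) = r powr (- p - 1) * r powr - (k - 1)"
    by (rule powr_add)
  also have "J * g powr - \<alpha> * (u powr (k - 1) * u powr (1 + p) * (r powr (- p - 1) * r powr - (k - 1)))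
      = u powr (k - 1) * u powr (1 + p) * (r powr (- p - 1) * (J * g powr - \<alpha> * r powr - (k - 1)))"
    by (simp only: mult_ac)
  also have "J * g powr - \<alpha> * r powr - (k - 1) = J / (g powr \<alpha> * r powr (k - 1))"
    by (simp only: powr_minus_divide) simp
  finally show ?thesis ..
qed

subsection \<open>Minkowski functionals and extended powers\<close>

lemma star_shaped_scaleR:
  assumes "star_shaped K" "x \<in> K" "0 \<le> a" "a \<le> 1"
  shows "a *\<^sub>R x \<in> K"
proof -
  have "a *\<^sub>R x \<in> closed_segment 0 x"
    using assms by (auto simp: closed_segment_def)
  then show ?thesis
    using assms unfolding star_shaped_def by blast
qed

text \<open>Star-shapedness puts \<open>z / d\<close> in \<open>K\<close> for every
  \<open>d > c\<close>; closedness allows \<open>d\<close> to decrease to \<open>c\<close>, so the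
  infimum is attained.\<close>

lemma minkowski_le_iff:
  assumes "closed K" "star_shaped K" "0 < c"
  shows "minkowski K z \<le> ennreal c \<longleftrightarrow> (1 / c) *\<^sub>R z \<in> K"
proof
  assume "(1 / c) *\<^sub>R z \<in> K"
  then have "z \<in> (\<lambda>y. c *\<^sub>R y) ` K"
    using assms(3) by (intro image_eqI[of _ _ "(1 / c) *\<^sub>R z"]) auto
  then show "minkowski K z \<le> ennreal c"
    unfolding minkowski_def using assms(3) by (intro Inf_lower) auto
next
  assume le: "minkowski K z \<le> ennreal c"
  have mem: "(1 / d) *\<^sub>R z \<in> K" if d: "c < d" for d
  proof -
    have "minkowski K z < ennreal d"
      using le by (rule le_less_trans) (use d assms(3) in \<open>simp add: ennreal_lessI\<close>)
    then obtain l y where l: "0 \<le> l" "ennreal l < ennreal d" "y \<in> K" "z = l *\<^sub>R y"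
      unfolding minkowski_def Inf_less_iff by auto
    then have "l < d"
      by (simp add: ennreal_less_iff)
    then have "(l / d) *\<^sub>R y \<in> K"
      using l d assms by (intro star_shaped_scaleR) auto
    then show ?thesis
      using l by simp
  qed
  have "(\<lambda>n. (1 / (c + inverse (real (Suc n)))) *\<^sub>R z) \<longlonglongrightarrow> (1 / (c + 0)) *\<^sub>R z"
    using assms(3) by (intro tendsto_intros LIMSEQ_inverse_real_of_nat) auto
  then show "(1 / c) *\<^sub>R z \<in> K"
    using closed_sequentially[OF assms(1), of "\<lambda>n. (1 / (c + inverse (real (Suc n)))) *\<^sub>R z"] mem
    by simp
qed

text \<open>By homogeneity, \<open>x / (\<Phi> x + e)\<close> lies in the sublevel set whenever
  \<open>\<Phi> x\<close> is finite; the positive \<open>e\<close> covers the case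
  \<open>\<Phi> x = 0\<close>. This turns a radial functional into the gauge of a set.\<close>

lemma minkowski_sublevel:
  fixes \<Phi> :: "'a::euclidean_space \<Rightarrow> ennreal"
  assumes hom: "\<And>c x. 0 < c \<Longrightarrow> \<Phi> (c *\<^sub>R x) = ennreal c * \<Phi> x" and \<Phi>0: "\<Phi> 0 = 0"
  shows "minkowski {x. \<Phi> x \<le> 1} x = \<Phi> x"
proof (rule antisym)
  show "minkowski {x. \<Phi> x \<le> 1} x \<le> \<Phi> x"
  proof (rule ennreal_le_epsilon)
    fix e :: real assume "\<Phi> x < top" and e: "0 < e"
    then obtain v where v: "0 \<le> v" "\<Phi> x = ennreal v"
      by (cases "\<Phi> x") auto
    have "\<Phi> ((1 / (v + e)) *\<^sub>R x) = ennreal (1 / (v + e)) * ennreal v"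
      using v e by (simp add: hom)
    also have "\<dots> = ennreal (v / (v + e))"
      using v e by (simp flip: ennreal_mult)
    also have "\<dots> \<le> 1"
      using v e by (simp add: ennreal_le_1)
    finally have "x \<in> (\<lambda>y. (v + e) *\<^sub>R y) ` {x. \<Phi> x \<le> 1}"
      using v e by (intro image_eqI[of _ _ "(1 / (v + e)) *\<^sub>R x"]) auto
    then have "minkowski {x. \<Phi> x \<le> 1} x \<le> ennreal (v + e)"
      unfolding minkowski_def using v e by (intro Inf_lower CollectI exI[of _ "v + e"]) auto
    then show "minkowski {x. \<Phi> x \<le> 1} x \<le> \<Phi> x + ennreal e"
      using v e by simp
  qed
  show "\<Phi> x \<le> minkowski {x. \<Phi> x \<le> 1} x"
    unfolding minkowski_def
  proof (rule Inf_greatest)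
    fix m assume "m \<in> {ennreal l |l. 0 \<le> l \<and> x \<in> (*\<^sub>R) l ` {x. \<Phi> x \<le> 1}}"
    then obtain l y where l: "0 \<le> l" and y: "\<Phi> y \<le> 1" and m: "m = ennreal l" "x = l *\<^sub>R y"
      by blast
    have "\<Phi> (l *\<^sub>R y) \<le> ennreal l"
    proof (cases "l = 0")
      case False
      then have "\<Phi> (l *\<^sub>R y) = ennreal l * \<Phi> y"
        using l hom by simp
      also have "\<dots> \<le> ennreal l * 1"
        using y by (rule mult_left_mono) simp
      finally show ?thesis by simp
    qed (simp add: \<Phi>0)
    then show "\<Phi> x \<le> m"
      by (simp only: m)
  qed
qed

section \<open>Calculus of powers on the extended half-line\<close>

lemma epowr_ennreal: "0 < x \<Longrightarrow> epowr (ennreal x) a = ennreal (x powr a)"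
  by (simp add: epowr_def)

lemma epowr_zero [simp]: "0 < a \<Longrightarrow> epowr 0 a = 0" "a < 0 \<Longrightarrow> epowr 0 a = \<infinity>"
  by (simp_all add: epowr_def)

lemma epowr_top [simp]: "0 < a \<Longrightarrow> epowr top a = top" "a < 0 \<Longrightarrow> epowr top a = 0"
  by (simp_all add: epowr_def)

lemma epowr_cases [case_names zero pos top]:
  fixes x :: ennreal
  obtains "x = 0" | v where "0 < v" "x = ennreal v" | "x = top"
proof (cases x)
  case (real r)
  then show ?thesis using that by (cases "r = 0") auto
qed (use that in auto)

lemma epowr_mono:
  assumes "0 < a" "x \<le> y"
  shows "epowr x a \<le> epowr y a"
proof (cases y rule: epowr_cases)
  case (pos w)
  then show ?thesis
    using assms by (cases x rule: epowr_cases) (auto simp: epowr_ennreal powr_mono2 top_unique intro!: ennreal_leI)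
qed (use assms in \<open>auto simp: top_unique\<close>)

lemma epowr_le_imp_le:
  assumes "0 < a" "0 < c" "epowr x a \<le> ennreal (c powr a)"
  shows "x \<le> ennreal c"
proof (cases x rule: epowr_cases)
  case (pos v)
  then have "v powr a \<le> c powr a"
    using assms by (simp add: epowr_ennreal)
  then have "v \<le> c"
    using assms pos by (meson not_le powr_less_mono2 less_imp_le)
  then show ?thesis using pos by (simp add: ennreal_leI)
qed (use assms in \<open>auto simp: top_unique\<close>)

lemma epowr_neg_le_one_iff:
  assumes "a < 0"
  shows "epowr x a \<le> 1 \<longleftrightarrow> 1 \<le> x"
proof (cases x rule: epowr_cases)
  case (pos v)
  have "v powr a \<le> 1 \<longleftrightarrow> 1 \<le> v"
  proof
    assume "v powr a \<le> 1"
    then show "1 \<le> v"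
      using powr_less_mono2_neg[of a v 1] assms pos by (cases "v < 1") auto
  next
    assume "1 \<le> v"
    then show "v powr a \<le> 1"
      using powr_mono2'[of a 1 v] assms by simp
  qed
  then show ?thesis using pos by (simp add: epowr_ennreal ennreal_le_1)
qed (use assms in \<open>auto simp: top_unique\<close>)

lemma epowr_mult_pos:
  assumes "0 < c"
  shows "epowr (ennreal c * x) a = ennreal (c powr a) * epowr x a"
proof (cases "a = 0")
  case True
  then show ?thesis using assms by (simp add: epowr_def)
next
  case False
  show ?thesis
  proof (cases x rule: epowr_cases)
    case (pos v)
    then have "ennreal c * x = ennreal (c * v)"
      using assms by (simp add: ennreal_mult)
    then have "epowr (ennreal c * x) a = ennreal ((c * v) powr a)"
      using pos assms by (simp only: epowr_ennreal mult_pos_pos)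
    then show ?thesis
      using pos assms by (simp add: epowr_ennreal powr_mult ennreal_mult)
  qed (use assms False in \<open>auto simp: epowr_def ennreal_mult_top\<close>)
qed

subsection \<open>Concave densities\<close>

text \<open>Prolong the segment from \<open>x\<close> through \<open>x0\<close> slightly to a point
  \<open>y\<close> of the open set. Then \<open>x0\<close> is a proper convex combination of
  \<open>x\<close> and \<open>y\<close>, and a positive value at \<open>x\<close> would force one at
  \<open>x0\<close>.\<close>

lemma concave_zero_on_open:
  fixes g :: "'a::euclidean_space \<Rightarrow> real"
  assumes "open S" "concave_on S g" and nonneg: "\<And>x. x \<in> S \<Longrightarrow> 0 \<le> g x"
    and x0: "x0 \<in> S" "g x0 = 0" and x: "x \<in> S"
  shows "g x = 0"
proof (cases "x = x0")
  case False
  obtain e where e: "0 < e" "ball x0 e \<subseteq> S"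
    using assms(1) x0 by (meson open_contains_ball)
  define \<delta> where "\<delta> = e / (2 * norm (x - x0))"
  have \<delta>: "0 < \<delta>" using e False by (simp add: \<delta>_def)
  define y where "y = x0 - \<delta> *\<^sub>R (x - x0)"
  have "dist x0 y < e"
    using e False by (simp add: y_def dist_norm \<delta>_def)
  then have y: "y \<in> S" using e by auto
  \<comment> \<open>This weight solves (1 - t) y + t x = x0.\<close>
  define t where "t = \<delta> / (1 + \<delta>)"
  have t: "0 < t" "t < 1" "t - (1 - t) * \<delta> = 0"
    using \<delta> by (auto simp: t_def field_simps)
  have "(1 - t) *\<^sub>R y + t *\<^sub>R x = x0 + (t - (1 - t) * \<delta>) *\<^sub>R (x - x0)"
    by (simp add: y_def algebra_simps)
  then have "(1 - t) * g y + t * g x \<le> g x0"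
    using concave_onD[OF assms(2), of t y x] t x y by simp
  moreover have "0 \<le> (1 - t) * g y"
    using nonneg[OF y] t by simp
  ultimately have "t * g x \<le> 0"
    using x0 by linarith
  then have "g x \<le> 0"
    using t by (simp add: mult_le_0_iff)
  then show ?thesis using nonneg[OF x] by simp
qed (use x0 in simp)

text \<open>The missing weight \<open>1 - a - b\<close> is placed at the origin, where
  \<open>g\<close> is nonnegative.\<close>

lemma concave_subcombination:
  fixes g :: "'a::real_vector \<Rightarrow> real"
  assumes g: "concave_on S g" and 0: "0 \<in> S" "0 \<le> g 0" and xy: "x \<in> S" "y \<in> S"
    and ab: "0 < a" "0 < b" "a + b \<le> 1"
  shows "a * g x + b * g y \<le> g (a *\<^sub>R x + b *\<^sub>R y)"
proof -
  define c where "c = a + b"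
  define z where "z = (1 - b / c) *\<^sub>R x + (b / c) *\<^sub>R y"
  have c: "0 < c" "c \<le> 1" "1 - b / c = a / c"
    using ab by (auto simp: c_def field_simps)
  have bc: "0 \<le> b / c" "b / c \<le> 1" using ab c by (auto simp: c_def)
  have z: "z \<in> S"
    unfolding z_def using concave_on_imp_convex[OF g] xy bc by (intro convexD) auto
  have "(1 - b / c) * g x + b / c * g y \<le> g z"
    unfolding z_def using concave_onD[OF g bc xy] .
  then have "c * (a / c * g x + b / c * g y) \<le> c * g z"
    using c by (intro mult_left_mono) auto
  then have "a * g x + b * g y \<le> c * g z"
    using c by (simp add: distrib_left)
  also have "\<dots> \<le> (1 - c) * g 0 + c * g z"
    using c 0 by simp
  also have "\<dots> \<le> g ((1 - c) *\<^sub>R 0 + c *\<^sub>R z)"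
    using concave_onD[OF g, of c 0 z] c 0 z by simp
  also have "(1 - c) *\<^sub>R 0 + c *\<^sub>R z = a *\<^sub>R x + b *\<^sub>R y"
    using c by (simp add: z_def scaleR_add_right)
  finally show ?thesis .
qed

text \<open>A zero of \<open>f\<close> would spread to all of \<open>\<Omega>\<close> by concavity,
  making \<open>\<mu>\<close> the zero measure. Its support would be empty, of affine dimension -1,
  against full dimensionality.\<close>

lemma borell_density_pos:
  fixes \<Omega> :: "'a::euclidean_space set"
  assumes "open \<Omega>" and f: "borell_density s \<Omega> \<mu> f" and x: "x \<in> \<Omega>"
  shows "0 < f x"
proof (rule ccontr)
  assume "\<not> 0 < f x"
  then have "f x = 0"
    using f x unfolding borell_density_def by force
  have "f y powr (s / (1 - real DIM('a) * s)) = 0" if "y \<in> \<Omega>" for y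
    by (rule concave_zero_on_open[OF assms(1) _ _ x _ that])
      (use f \<open>f x = 0\<close> in \<open>auto simp: borell_density_def\<close>)
  then have f0: "f y = 0" if "y \<in> \<Omega>" for y
    using that by simp
  have "emeasure \<mu> (U \<inter> \<Omega>) = 0" if "open U" for U
  proof -
    have \<mu>: "\<mu> = density (restrict_space lborel \<Omega>) (\<lambda>x. ennreal (f x))"
      using f unfolding borell_density_def by blast
    \<comment> \<open>The measurability demanded by \<open>emeasure_density\<close> is inherited
      from the constant 0, with which \<open>f\<close> agrees on \<open>\<Omega>\<close>.\<close>
    have "(\<lambda>x. ennreal (f x)) \<in> borel_measurable (restrict_space lborel \<Omega>)
        \<longleftrightarrow> (\<lambda>x. 0 :: ennreal) \<in> borel_measurable (restrict_space lborel \<Omega>)"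
      using f0 by (intro measurable_cong) (simp add: space_restrict_space)
    then have "(\<lambda>x. ennreal (f x)) \<in> borel_measurable (restrict_space lborel \<Omega>)"
      by simp
    moreover have "U \<inter> \<Omega> \<in> sets (restrict_space lborel \<Omega>)"
      using that assms(1) by (auto simp: sets_restrict_space image_iff)
    ultimately have "emeasure \<mu> (U \<inter> \<Omega>)
        = (\<integral>\<^sup>+x. ennreal (f x) * indicator (U \<inter> \<Omega>) x \<partial>restrict_space lborel \<Omega>)"
      unfolding \<mu> by (rule emeasure_density)
    also have "\<dots> = (\<integral>\<^sup>+x. 0 \<partial>restrict_space lborel \<Omega>)"
      using f0 by (intro nn_integral_cong) (auto simp: indicator_def)
    finally show ?thesis by simp
  qed
  then have "measure_support \<Omega> \<mu> = {}"
    unfolding measure_support_def using open_UNIV by fastforce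
  then have "aff_dim (measure_support \<Omega> \<mu>) = - 1"
    by (simp only: aff_dim_empty)
  moreover have "aff_dim (measure_support \<Omega> \<mu>) = int DIM('a)"
    using f unfolding borell_density_def by blast
  ultimately show False by simp
qed

text \<open>A concave function on an open set is continuous; strict positivity of \<open>f\<close>
  allows the power to be undone continuously.\<close>

lemma borell_density_continuous:
  fixes \<Omega> :: "'a::euclidean_space set"
  assumes "open \<Omega>" and s: "0 < s" "s < 1 / real DIM('a)" and f: "borell_density s \<Omega> \<mu> f"
  shows "continuous_on \<Omega> f"
proof -
  define \<beta> where "\<beta> = s / (1 - real DIM('a) * s)"
  have \<beta>: "0 < \<beta>" using s by (simp add: \<beta>_def field_simps)
  have "continuous_on \<Omega> (\<lambda>x. - (f x powr \<beta>))"
    using f assms(1) by (intro convex_on_continuous) (simp_all add: borell_density_def concave_on_def \<beta>_def)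
  then have "continuous_on \<Omega> (\<lambda>x. - (- (f x powr \<beta>)))"
    by (rule continuous_on_minus)
  then have "continuous_on \<Omega> (\<lambda>x. (- (- (f x powr \<beta>))) powr (1 / \<beta>))"
    using borell_density_pos[OF assms(1) f]
    by (intro continuous_on_powr continuous_on_const) fastforce+
  moreover have "(- (- (f x powr \<beta>))) powr (1 / \<beta>) = f x" if "x \<in> \<Omega>" for x
    using borell_density_pos[OF assms(1) f that] \<beta> by (simp add: powr_powr)
  ultimately show ?thesis
    by (simp cong: continuous_on_cong)
qed

subsection \<open>The body of a density on a star-shaped set\<close>

text \<open>Upper semicontinuity of a nonnegative continuous function on a closed set, extended by
  0: off \<open>K\<close> the terms are eventually 0, while at a point of \<open>K\<close> only the
  terms inside \<open>K\<close> matter.\<close>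

lemma limsup_indicator_le:
  fixes \<phi> :: "'a::metric_space \<Rightarrow> real"
  assumes "closed K" "continuous_on K \<phi>" and nonneg: "\<And>z. z \<in> K \<Longrightarrow> 0 \<le> \<phi> z" and Y: "Y \<longlonglongrightarrow> z"
  shows "limsup (\<lambda>n. indicator K (Y n) * ennreal (\<phi> (Y n))) \<le> indicator K z * ennreal (\<phi> z)"
proof (cases "z \<in> K")
  case False
  then have "\<forall>\<^sub>F n in sequentially. Y n \<in> - K"
    using assms(1) Y by (intro topological_tendstoD) auto
  then have "\<forall>\<^sub>F n in sequentially. indicator K (Y n) * ennreal (\<phi> (Y n)) \<le> 0"
    by eventually_elim auto
  then have "limsup (\<lambda>n. indicator K (Y n) * ennreal (\<phi> (Y n))) \<le> 0"
    by (rule Limsup_bounded)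
  then show ?thesis by simp
next
  case True
  show ?thesis
  proof (rule ennreal_le_epsilon)
    fix e :: real assume e: "0 < e"
    have "(\<phi> \<longlongrightarrow> \<phi> z) (at z within K)"
      using assms(2) True by (simp add: continuous_on_def)
    then have "\<forall>\<^sub>F y in at z within K. \<phi> y < \<phi> z + e"
      using e by (intro order_tendstoD(2)) auto
    then have "\<forall>\<^sub>F y in nhds z. y \<in> K \<longrightarrow> \<phi> y < \<phi> z + e"
      unfolding eventually_at_filter by eventually_elim (use e in auto)
    then have "\<forall>\<^sub>F n in sequentially. Y n \<in> K \<longrightarrow> \<phi> (Y n) < \<phi> z + e"
      using Y by (rule eventually_compose_filterlim)
    then have "\<forall>\<^sub>F n in sequentially. indicator K (Y n) * ennreal (\<phi> (Y n)) \<le> ennreal (\<phi> z + e)"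
      by eventually_elim (auto simp: indicator_def intro!: ennreal_leI)
    then have "limsup (\<lambda>n. indicator K (Y n) * ennreal (\<phi> (Y n))) \<le> ennreal (\<phi> z + e)"
      by (rule Limsup_bounded)
    then show "limsup (\<lambda>n. indicator K (Y n) * ennreal (\<phi> (Y n)))
        \<le> indicator K z * ennreal (\<phi> z) + ennreal e"
      using True nonneg e by (simp add: ennreal_plus)
  qed
qed

locale star_body_density =
  fixes K :: "'a::euclidean_space set" and f :: "'a \<Rightarrow> real" and k :: real
  assumes compact: "compact K" and star: "star_shaped K" and interior: "interior K \<noteq> {}"
    and cont: "continuous_on K f" and pos: "\<And>x. x \<in> K \<Longrightarrow> 0 < f x" and k: "1 \<le> k"
begin

definition ray_integral :: "'a \<Rightarrow> ennreal" where
  "ray_integral x = (\<integral>\<^sup>+ r\<in>{0<..}. (indicator K (r *\<^sub>R x) * ennreal (f (r *\<^sub>R x)) * ennreal (r powr (k - 1)))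
    \<partial>lborel)"

lemma radial_functional_eq:
  "radial_functional K f k x = (if x = 0 then 0 else epowr (ray_integral x) (- (1 / k)))"
  by (simp add: radial_functional_def ray_integral_def)

lemma closed: "closed K"
  using compact by (rule compact_imp_closed)

text \<open>Only the product with the indicator is measured, since \<open>f\<close> is controlled on
  \<open>K\<close> alone.\<close>

lemma measurable_weight [measurable]:
  "(\<lambda>z. indicator K z * ennreal (f z)) \<in> borel_measurable borel"
proof -
  have "(\<lambda>z. ennreal (indicator K z *\<^sub>R f z)) \<in> borel_measurable borel"
    using closed cont by (intro measurable_compose[OF borel_measurable_continuous_on_indicator] measurable_ennreal) auto
  moreover have "(\<lambda>z. ennreal (indicator K z *\<^sub>R f z)) = (\<lambda>z. indicator K z * ennreal (f z))"
    by (auto simp: indicator_def)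
  ultimately show ?thesis by simp
qed

lemma measurable_ray [measurable]:
  "(\<lambda>r. indicator K (r *\<^sub>R x) * ennreal (f (r *\<^sub>R x)) * ennreal (r powr (k - 1)) * indicator {0<..} r)
    \<in> borel_measurable borel"
proof -
  have "(\<lambda>r. indicator K (r *\<^sub>R x) * ennreal (f (r *\<^sub>R x))) \<in> borel_measurable borel"
    by (rule measurable_compose[OF _ measurable_weight]) measurable
  then show ?thesis by measurable
qed

text \<open>Substitute \<open>c * r\<close> for \<open>r\<close>: the differential contributes
  \<open>c\<close> and the weight \<open>c powr (k - 1)\<close>. Degree \<open>- k\<close> here
  makes the radial functional homogeneous of degree 1.\<close>

lemma ray_integral_scaleR:
  assumes c: "0 < c"
  shows "ray_integral (c *\<^sub>R x) = ennreal (c powr - k) * ray_integral x"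
proof -
  let ?G = "\<lambda>r. indicator K (r *\<^sub>R x) * ennreal (f (r *\<^sub>R x)) * ennreal (r powr (k - 1)) * indicator {0<..} r"
  have "ray_integral x = ennreal \<bar>c\<bar> * (\<integral>\<^sup>+r. ?G (0 + c * r) \<partial>lborel)"
    unfolding ray_integral_def using c by (intro nn_integral_real_affine measurable_ray) auto
  also have "(\<integral>\<^sup>+r. ?G (0 + c * r) \<partial>lborel)
    = (\<integral>\<^sup>+r. ennreal (c powr (k - 1)) * (indicator K (r *\<^sub>R c *\<^sub>R x) * ennreal (f (r *\<^sub>R c *\<^sub>R x)) *
        ennreal (r powr (k - 1)) * indicator {0<..} r) \<partial>lborel)"
    using c by (intro nn_integral_cong)
      (auto simp: indicator_def powr_mult ennreal_mult mult_ac zero_less_mult_iff)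
  also have "\<dots> = ennreal (c powr (k - 1)) * ray_integral (c *\<^sub>R x)"
    unfolding ray_integral_def by (intro nn_integral_cmult) measurable
  finally have "ray_integral x = ennreal (c * c powr (k - 1)) * ray_integral (c *\<^sub>R x)"
    using c by (simp add: ennreal_mult mult.assoc)
  also have "c * c powr (k - 1) = c powr k"
    using c by (simp add: powr_mult_base)
  finally have "ennreal (c powr - k) * ray_integral x
      = ennreal (c powr - k) * ennreal (c powr k) * ray_integral (c *\<^sub>R x)"
    by (simp add: mult.assoc)
  also have "ennreal (c powr - k) * ennreal (c powr k) = 1"
    using c by (simp flip: ennreal_mult powr_add)
  finally show ?thesis by simp
qed

lemma radial_functional_scaleR:
  assumes c: "0 < c"
  shows "radial_functional K f k (c *\<^sub>R x) = ennreal c * radial_functional K f k x"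
proof -
  have "(c powr - k) powr - (1 / k) = c"
    using c k by (simp add: powr_powr)
  then show ?thesis
    using c by (simp add: radial_functional_eq ray_integral_scaleR epowr_mult_pos)
qed

section \<open>The unit sublevel set of the radial functional is a star-shaped body\<close>

definition radial_body :: "'a set" where
  "radial_body = {x. radial_functional K f k x \<le> 1}"

lemma minkowski_radial_body: "minkowski radial_body x = radial_functional K f k x"
  unfolding radial_body_def
  by (rule minkowski_sublevel[OF radial_functional_scaleR]) (simp_all add: radial_functional_eq)

lemma mem_radial_body_iff: "x \<in> radial_body \<longleftrightarrow> x = 0 \<or> 1 \<le> ray_integral x"
  using k by (simp add: radial_body_def radial_functional_eq epowr_neg_le_one_iff)

lemma zero_mem_radial_body: "0 \<in> radial_body"
  by (simp add: mem_radial_body_iff)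

lemma star_shaped_radial_body: "star_shaped radial_body"
  unfolding star_shaped_def
proof (intro conjI ballI subsetI)
  fix x y assume x: "x \<in> radial_body" and "y \<in> closed_segment 0 x"
  then obtain u where u: "0 \<le> u" "u \<le> 1" "y = u *\<^sub>R x"
    by (auto simp: closed_segment_def)
  show "y \<in> radial_body"
  proof (cases "u = 0")
    case False
    then have "radial_functional K f k y = ennreal u * radial_functional K f k x"
      using u radial_functional_scaleR by simp
    also have "\<dots> \<le> 1 * 1"
      using x u by (intro mult_mono) (auto simp: radial_body_def ennreal_le_1)
    finally show ?thesis by (simp add: radial_body_def)
  qed (simp add: u zero_mem_radial_body)
qed (rule zero_mem_radial_body)

text \<open>A point \<open>r x\<close> of \<open>K\<close> has norm at most \<open>B\<close>, which
  forces \<open>r \<le> \<rho>\<close>. Leaving \<open>\<rho>\<close> free lets one majorant serve a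
  whole sequence of directions.\<close>

lemma integrand_le:
  assumes C: "\<And>z. z \<in> K \<Longrightarrow> f z \<le> C" and B: "\<And>z. z \<in> K \<Longrightarrow> norm z \<le> B"
    and x: "x \<noteq> 0" "B \<le> \<rho> * norm x"
  shows "indicator K (r *\<^sub>R x) * ennreal (f (r *\<^sub>R x)) * ennreal (r powr (k - 1)) * indicator {0<..} r
    \<le> ennreal (C * \<rho> powr (k - 1)) * indicator {0..\<rho>} r"
proof (cases "r *\<^sub>R x \<in> K \<and> 0 < r")
  case True
  then have "r * norm x \<le> B"
    using B[of "r *\<^sub>R x"] by simp
  then have "r * norm x \<le> \<rho> * norm x"
    using x(2) by (rule order_trans)
  then have r: "r \<le> \<rho>" using x by simp
  have "f (r *\<^sub>R x) * r powr (k - 1) \<le> C * \<rho> powr (k - 1)"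
    using True C[of "r *\<^sub>R x"] pos[of "r *\<^sub>R x"] r k by (intro mult_mono powr_mono2) auto
  then show ?thesis
    using True r pos[of "r *\<^sub>R x"] by (simp add: ennreal_leI flip: ennreal_mult)
qed (auto simp: indicator_def)

lemma obtain_bounds:
  obtains B C where "0 < B" "0 < C" "\<And>z. z \<in> K \<Longrightarrow> norm z \<le> B" "\<And>z. z \<in> K \<Longrightarrow> f z \<le> C"
proof -
  obtain B where B: "0 < B" "\<forall>z\<in>K. norm z \<le> B"
    using compact_imp_bounded[OF compact] bounded_pos by blast
  have "bounded (f ` K)"
    using compact_continuous_image[OF cont compact] by (rule compact_imp_bounded)
  then obtain C where "0 < C" "\<forall>z\<in>K. norm (f z) \<le> C"
    using bounded_pos by (metis image_eqI)
  then show ?thesis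
    using B by (intro that[of B C]) force+
qed

text \<open>With \<rho> = B / |x| the ray mass is at most C \<rho>^k, and membership requires this
  to be at least 1.\<close>

lemma bounded_radial_body: "bounded radial_body"
proof -
  obtain B C where BC: "0 < B" "0 < C" "\<And>z. z \<in> K \<Longrightarrow> norm z \<le> B" "\<And>z. z \<in> K \<Longrightarrow> f z \<le> C"
    by (rule obtain_bounds) blast
  have "norm x \<le> B * C powr (1 / k)" if "x \<in> radial_body" for x
  proof (cases "x = 0")
    case False
    define \<rho> where "\<rho> = B / norm x"
    have \<rho>: "0 < \<rho>" using False BC by (simp add: \<rho>_def)
    have "1 \<le> ray_integral x"
      using that False by (simp add: mem_radial_body_iff)
    also have "\<dots> \<le> (\<integral>\<^sup>+r. ennreal (C * \<rho> powr (k - 1)) * indicator {0..\<rho>} r \<partial>lborel)"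
      unfolding ray_integral_def using BC False
      by (intro nn_integral_mono integrand_le[where B = B]) (auto simp: \<rho>_def)
    also have "\<dots> = ennreal (C * \<rho> powr (k - 1)) * ennreal \<rho>"
      using \<rho> by (simp add: nn_integral_cmult)
    also have "\<dots> = ennreal (C * (\<rho> * \<rho> powr (k - 1)))"
      using \<rho> BC by (simp add: mult_ac flip: ennreal_mult)
    also have "\<rho> * \<rho> powr (k - 1) = \<rho> powr k"
      using \<rho> by (simp add: powr_mult_base)
    finally have "1 \<le> C * \<rho> powr k"
      by (simp add: ennreal_1[symmetric] del: ennreal_1) (use BC in \<open>simp add: ennreal_le_iff2\<close>)
    then have "1 powr (1 / k) \<le> (C * \<rho> powr k) powr (1 / k)"
      using k by (intro powr_mono2) auto
    also have "\<dots> = C powr (1 / k) * \<rho>"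
      using \<rho> BC k by (simp add: powr_mult powr_powr)
    finally show ?thesis
      using False by (simp add: \<rho>_def field_simps)
  qed (use BC in simp)
  then show ?thesis by (auto simp: bounded_iff)
qed

text \<open>Reverse Fatou: the ray integral is upper semicontinuous away from 0 because its
  integrand is and has an integrable majorant.\<close>

lemma closed_radial_body: "closed radial_body"
  unfolding closed_sequential_limits
proof (intro allI impI, elim conjE)
  fix X x assume X: "\<forall>n. X n \<in> radial_body" and lim: "X \<longlonglongrightarrow> x"
  show "x \<in> radial_body"
  proof (cases "x = 0")
    case False
    obtain B C where BC: "0 < B" "0 < C" "\<And>z. z \<in> K \<Longrightarrow> norm z \<le> B" "\<And>z. z \<in> K \<Longrightarrow> f z \<le> C"
      by (rule obtain_bounds) blast
    have "(\<lambda>n. norm (X n)) \<longlonglongrightarrow> norm x"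
      using lim by (rule tendsto_norm)
    then have "\<forall>\<^sub>F n in sequentially. norm x / 2 < norm (X n)"
      using False by (intro order_tendstoD(1)) auto
    then obtain N where N: "\<And>n. N \<le> n \<Longrightarrow> norm x / 2 < norm (X n)"
      by (auto simp: eventually_sequentially)
    \<comment> \<open>Dropping initial terms keeps the norms above \<open>norm x / 2\<close>, so a
      single cutoff \<open>\<rho>\<close> bounds all integrands.\<close>
    define Y where "Y = (\<lambda>n. X (n + N))"
    have Y: "Y \<longlonglongrightarrow> x" "\<And>n. norm x / 2 < norm (Y n)" "\<And>n. Y n \<in> radial_body"
      using lim N X by (auto simp: Y_def intro: LIMSEQ_ignore_initial_segment)
    have Y0: "Y n \<noteq> 0" for n
      using Y(2)[of n] False by auto
    define \<rho> where "\<rho> = 2 * B / norm x"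
    have \<rho>: "0 < \<rho>" using False BC by (simp add: \<rho>_def)
    define w where "w = (\<lambda>r. ennreal (C * \<rho> powr (k - 1)) * indicator {0..\<rho>} r)"
    let ?u = "\<lambda>n r. indicator K (r *\<^sub>R Y n) * ennreal (f (r *\<^sub>R Y n)) * ennreal (r powr (k - 1)) * indicator {0<..} r"
    have "1 \<le> limsup (\<lambda>n. ray_integral (Y n))"
    proof -
      have "limsup (\<lambda>n. (1::ennreal)) \<le> limsup (\<lambda>n. ray_integral (Y n))"
        using Y(3) Y0 by (intro Limsup_mono always_eventually) (auto simp: mem_radial_body_iff)
      then show ?thesis by (simp add: Limsup_const)
    qed
    also have "\<dots> \<le> (\<integral>\<^sup>+r. limsup (\<lambda>n. ?u n r) \<partial>lborel)"
      unfolding ray_integral_def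
    proof (rule nn_integral_limsup)
      show "w \<in> borel_measurable lborel"
        unfolding w_def by measurable
      show "AE r in lborel. ?u n r \<le> w r" for n
      proof (intro AE_I2)
        fix r
        have "B = \<rho> * (norm x / 2)" using False by (simp add: \<rho>_def)
        also have "\<dots> \<le> \<rho> * norm (Y n)"
          using Y(2)[of n] \<rho> by (intro mult_left_mono) auto
        finally show "?u n r \<le> w r"
          unfolding w_def using BC Y0 by (intro integrand_le[where B = B]) auto
      qed
      show "(\<integral>\<^sup>+r. w r \<partial>lborel) < \<infinity>"
        unfolding w_def using \<rho> by (simp add: nn_integral_cmult ennreal_mult_less_top)
    qed (use measurable_ray in simp)
    also have "\<dots> \<le> ray_integral x"
      unfolding ray_integral_def
    proof (rule nn_integral_mono)
      fix r :: real
      show "limsup (\<lambda>n. ?u n r) \<le>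
        indicator K (r *\<^sub>R x) * ennreal (f (r *\<^sub>R x)) * ennreal (r powr (k - 1)) * indicator {0<..} r"
      proof (cases "0 < r")
        case True
        \<comment> \<open>For fixed \<open>r\<close> the radial weight is absorbed into the
          continuous function on \<open>K\<close>.\<close>
        have "limsup (\<lambda>n. indicator K (r *\<^sub>R Y n) * ennreal (f (r *\<^sub>R Y n) * r powr (k - 1)))
          \<le> indicator K (r *\<^sub>R x) * ennreal (f (r *\<^sub>R x) * r powr (k - 1))"
        proof (rule limsup_indicator_le[OF closed])
          show "0 \<le> f z * r powr (k - 1)" if "z \<in> K" for z
            using pos[OF that] by simp
        qed (intro continuous_intros cont tendsto_intros Y(1))+
        moreover have "indicator K z * ennreal (f z * r powr (k - 1))
            = indicator K z * ennreal (f z) * ennreal (r powr (k - 1))" for z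
          using pos[of z] by (cases "z \<in> K") (auto simp: ennreal_mult)
        ultimately show ?thesis using True by simp
      qed (simp add: Limsup_const)
    qed
    finally show ?thesis by (simp add: mem_radial_body_iff)
  qed (simp add: zero_mem_radial_body)
qed

lemma compact_radial_body: "compact radial_body"
  using bounded_radial_body closed_radial_body by (simp add: compact_eq_bounded_closed)

text \<open>A small dilate of \<open>K\<close> fits inside: for \<open>z\<close> in \<open>K\<close>
  the radii in \<open>[1/2, 1]\<close> already contribute a fixed positive mass \<open>c\<close>,
  and scaling by c^(1/k) normalises it to 1.\<close>

lemma interior_radial_body: "interior radial_body \<noteq> {}"
proof -
  have "K \<noteq> {}" using interior by auto
  then obtain z0 where z0: "z0 \<in> K" "\<And>z. z \<in> K \<Longrightarrow> f z0 \<le> f z"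
    using continuous_attains_inf[OF compact _ cont] by blast
  \<comment> \<open>Minimum of \<open>f\<close>, times the least weight on \<open>[1/2, 1]\<close>,
    times the length \<open>1/2\<close>.\<close>
  define c where "c = f z0 * (1 / 2) powr (k - 1) / 2"
  have c: "0 < c" using pos[OF z0(1)] by (simp add: c_def)
  define a where "a = c powr (1 / k)"
  have a: "0 < a" using c by (simp add: a_def)
  have "(\<lambda>z. a *\<^sub>R z) ` K \<subseteq> radial_body"
  proof safe
    fix z assume z: "z \<in> K"
    show "a *\<^sub>R z \<in> radial_body"
    proof (cases "z = 0")
      case False
      have "ennreal c = ennreal (f z0 * (1 / 2) powr (k - 1) * (1 / 2))"
        by (simp add: c_def)
      also have "\<dots> = ennreal (f z0 * (1 / 2) powr (k - 1)) * ennreal (1 / 2)"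
        by (rule ennreal_mult) (use pos[OF z0(1)] in auto)
      also have "\<dots> = (\<integral>\<^sup>+r. ennreal (f z0 * (1 / 2) powr (k - 1)) * indicator {1/2..1::real} r \<partial>lborel)"
        by (simp add: nn_integral_cmult)
      also have "\<dots> \<le> ray_integral z"
        unfolding ray_integral_def
      proof (rule nn_integral_mono)
        fix r :: real
        show "ennreal (f z0 * (1 / 2) powr (k - 1)) * indicator {1/2..1} r \<le>
          indicator K (r *\<^sub>R z) * ennreal (f (r *\<^sub>R z)) * ennreal (r powr (k - 1)) * indicator {0<..} r"
        proof (cases "r \<in> {1/2..1}")
          case True
          then have rz: "r *\<^sub>R z \<in> K"
            using star z by (intro star_shaped_scaleR) auto
          have "f z0 * (1 / 2) powr (k - 1) \<le> f (r *\<^sub>R z) * r powr (k - 1)"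
            using True rz z0 pos[OF rz] k by (intro mult_mono powr_mono2) auto
          then show ?thesis
            using True rz pos[OF rz] by (simp add: ennreal_leI flip: ennreal_mult)
        qed simp
      qed
      finally have "ennreal (a powr - k) * ennreal c \<le> ray_integral (a *\<^sub>R z)"
        unfolding ray_integral_scaleR[OF a] by (rule mult_left_mono) simp
      moreover have "a powr - k * c = 1"
        using c k by (simp add: a_def powr_powr powr_minus_divide)
      ultimately show ?thesis
        using c by (simp add: mem_radial_body_iff flip: ennreal_mult)
    qed (simp add: zero_mem_radial_body)
  qed
  then have "(\<lambda>z. a *\<^sub>R z) ` interior K \<subseteq> radial_body"
    using interior_subset by blast
  moreover have "open ((\<lambda>z. a *\<^sub>R z) ` interior K)"
    using a by (intro open_scaling) auto
  ultimately have "(\<lambda>z. a *\<^sub>R z) ` interior K \<subseteq> interior radial_body"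
    by (rule interior_maximal)
  then show ?thesis using interior by auto
qed

section \<open>Ray masses as integrals of continuous functions over compact intervals\<close>

text \<open>Continuous at \<open>0\<close> also for \<open>k = 1\<close>, unlike \<^term>\<open>r powr (k - 1)\<close> with its junk value
  \<open>0 powr 0 = 0\<close>.\<close>

definition rpow :: "real \<Rightarrow> real" where
  "rpow r = (if k = 1 then 1 else r powr (k - 1))"

lemma rpow_eq: "0 < r \<Longrightarrow> rpow r = r powr (k - 1)"
  by (simp add: rpow_def)

lemma continuous_on_rpow: "continuous_on {0..R} rpow"
proof (cases "k = 1")
  case False
  then have "continuous_on {0..R} (\<lambda>r. r powr (k - 1))"
    using k by (intro continuous_on_powr' continuous_intros) auto
  then show ?thesis using False by (simp add: rpow_def[abs_def])
next
  case True
  then have "rpow r = 1" for r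
    unfolding rpow_def by (rule if_P)
  then have "rpow = (\<lambda>r. 1)"
    by (rule ext)
  then show ?thesis
    by (simp only: continuous_on_const)
qed

text \<open>A compact star-shaped set meets the ray in an initial segment. Its length
  \<open>R\<close> may be 0, as the origin may be a boundary point; \<open>rpow\<close> differs from
  the original weight only on a null set.\<close>

lemma ray_integral_eq:
  assumes x: "x \<noteq> 0"
  obtains R where "0 \<le> R" and "\<And>r. 0 \<le> r \<Longrightarrow> r *\<^sub>R x \<in> K \<longleftrightarrow> r \<le> R"
    and "continuous_on {0..R} (\<lambda>r. f (r *\<^sub>R x) * rpow r)"
    and "ray_integral x = ennreal (integral {0..R} (\<lambda>r. f (r *\<^sub>R x) * rpow r))"
proof -
  define S where "S = {0..} \<inter> (\<lambda>r. r *\<^sub>R x) -` K"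
  obtain B where B: "\<And>z. z \<in> K \<Longrightarrow> norm z \<le> B"
    by (rule obtain_bounds) blast
  have "closed S"
    unfolding S_def by (intro closed_Int closed_atLeast continuous_closed_vimage closed) (auto intro!: continuous_intros)
  moreover have "norm r \<le> B / norm x" if "r \<in> S" for r
    using that x B[of "r *\<^sub>R x"] by (auto simp: S_def field_simps)
  then have "bounded S" by (auto simp: bounded_iff)
  ultimately have "compact S" by (simp add: compact_eq_bounded_closed)
  moreover have "0 \<in> S" using star by (simp add: S_def star_shaped_def)
  ultimately obtain R where R: "R \<in> S" "\<And>r. r \<in> S \<Longrightarrow> r \<le> R"
    using compact_attains_sup[of S] by auto
  have R0: "0 \<le> R" using R(1) by (simp add: S_def)
  have mem: "r *\<^sub>R x \<in> K \<longleftrightarrow> r \<le> R" if r: "0 \<le> r" for r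
  proof
    assume "r *\<^sub>R x \<in> K"
    then show "r \<le> R" using R(2)[of r] r by (simp add: S_def)
  next
    assume "r \<le> R"
    show "r *\<^sub>R x \<in> K"
    proof (cases "R = 0")
      case True
      then show ?thesis using r \<open>r \<le> R\<close> star by (simp add: star_shaped_def)
    next
      case False
      have "(r / R) *\<^sub>R (R *\<^sub>R x) \<in> K"
        by (rule star_shaped_scaleR[OF star]) (use R(1) R0 r \<open>r \<le> R\<close> False in \<open>auto simp: S_def\<close>)
      then show ?thesis using False by simp
    qed
  qed
  let ?F = "\<lambda>r. f (r *\<^sub>R x) * rpow r"
  have contF: "continuous_on {0..R} ?F"
    by (intro continuous_on_mult continuous_on_rpow continuous_on_compose2[OF cont] continuous_intros)
      (use mem in auto)
  have "(\<integral>\<^sup>+r. ennreal (indicator {0..R} r * ?F r) \<partial>lborel) = ennreal (integral {0..R} ?F)"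
  proof (rule nn_integral_has_integral_lebesgue)
    show "0 \<le> ?F r" if "r \<in> {0..R}" for r
      using that mem[of r] pos[of "r *\<^sub>R x"] by (auto simp: rpow_def)
    show "(?F has_integral integral {0..R} ?F) {0..R}"
      using contF by (intro integrable_integral integrable_continuous_real)
  qed
  moreover have "ray_integral x = (\<integral>\<^sup>+r. ennreal (indicator {0..R} r * ?F r) \<partial>lborel)"
    unfolding ray_integral_def
  proof (rule nn_integral_cong_AE)
    have "AE r in lborel. r \<noteq> (0::real)"
      by (rule AE_lborel_singleton)
    then show "AE r in lborel. indicator K (r *\<^sub>R x) * ennreal (f (r *\<^sub>R x)) * ennreal (r powr (k - 1)) *
        indicator {0<..} r = ennreal (indicator {0..R} r * ?F r)"
    proof eventually_elim
      case (elim r)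
      show ?case
      proof (cases "0 < r")
        case True
        then show ?thesis
          using mem[of r] pos[of "r *\<^sub>R x"] by (cases "r \<le> R") (auto simp: rpow_eq ennreal_mult)
      qed (use elim in auto)
    qed
  qed
  ultimately show ?thesis
    using that[OF R0 mem contF] by simp
qed

section \<open>The growth estimate and the triangle inequality for the radial functional\<close>

text \<open>Supplies the pointwise hypothesis of \<open>integral_ge_of_transport\<close>. The
  weights \<open>l1\<close>, \<open>l2\<close> sum to 1 by the definition of \<open>psum\<close>,
  and concavity bounds the density at \<open>u (x + y)\<close> from below.\<close>

lemma transport_inequality:
  fixes \<Omega> :: "'a set" and \<alpha> p r t J1 J2 :: real and x y :: 'a
  assumes p: "0 < p" "p \<le> 1" and \<alpha>: "0 < \<alpha>"
    and \<Omega>: "K \<subseteq> \<Omega>" "concave_on \<Omega> (\<lambda>z. f z powr (1 / \<alpha>))"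
    and rt: "0 < r" "r *\<^sub>R x \<in> K" "0 < t" "t *\<^sub>R y \<in> K" and xy: "psum p r t *\<^sub>R (x + y) \<in> K"
    and J: "0 < J1" "0 < J2"
  defines "m \<equiv> (1 / p - 1) * \<alpha> + k / p" and "F \<equiv> \<lambda>z r. f (r *\<^sub>R z) * rpow r"
  shows "(J1 powr (- 1 / m) + J2 powr (- 1 / m)) powr (- m)
    \<le> F (x + y) (psum p r t) * (psum p r t powr (1 + p) *
      (r powr (- p - 1) * (J1 / F x r) + t powr (- p - 1) * (J2 / F y t)))"
proof -
  define u where "u = psum p r t"
  define g where "g = (\<lambda>z. f z powr (1 / \<alpha>))"
  define l1 where "l1 = (u / r) powr p"
  define l2 where "l2 = (u / t) powr p"
  have u: "0 < u" unfolding u_def using rt by (intro psum_pos)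
  have l: "0 < l1" "0 < l2" using u rt by (auto simp: l1_def l2_def)
  have "l1 + l2 = u powr p * u powr - p"
    using p rt u psum_powr[of p r t]
    by (simp add: l1_def l2_def u_def[symmetric] powr_divide powr_minus_divide distrib_left)
  then have l12: "l1 + l2 = 1"
    using u by (simp flip: powr_add)
  have root: "l1 powr (1 / p) = u / r" "l2 powr (1 / p) = u / t"
    using p u rt by (auto simp: l1_def l2_def powr_powr)
  \<comment> \<open>Splits \<open>u / r\<close> as \<open>l1 * l1 powr (1 / p - 1)\<close>, so that
    the concavity bound becomes a convex combination with weights \<open>l1\<close>,
    \<open>l2\<close>.\<close>
  have split: "a powr (1 / p) = a * a powr (1 / p - 1)" if "0 < a" for a
    using that by (simp add: powr_mult_base)
  \<comment> \<open>Here \<open>p \<le> 1\<close> enters: a number in [0, 1] does not increase when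
    raised to the power \<open>1 / p\<close>.\<close>
  have "u / r + u / t \<le> l1 + l2"
    unfolding root[symmetric] using p l l12 by (intro add_mono powr_le_one_le) auto
  then have ab: "u / r + u / t \<le> 1" using l12 by simp
  have g: "0 < g z" "f z = g z powr \<alpha>" if "z \<in> K" for z
    using pos[OF that] \<alpha> by (auto simp: g_def powr_powr)
  have "u / r * g (r *\<^sub>R x) + u / t * g (t *\<^sub>R y) \<le> g ((u / r) *\<^sub>R (r *\<^sub>R x) + (u / t) *\<^sub>R (t *\<^sub>R y))"
    using \<Omega> rt u ab star
    by (intro concave_subcombination[where S = \<Omega>]) (auto simp: g_def star_shaped_def)
  also have "(u / r) *\<^sub>R (r *\<^sub>R x) + (u / t) *\<^sub>R (t *\<^sub>R y) = u *\<^sub>R (x + y)"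
    using rt by (simp add: scaleR_add_right)
  finally have conc: "l1 * (l1 powr (1 / p - 1) * g (r *\<^sub>R x)) + l2 * (l2 powr (1 / p - 1) * g (t *\<^sub>R y))
      \<le> g (u *\<^sub>R (x + y))"
    unfolding root[symmetric] using l by (simp add: split mult.assoc)
  have gpos: "0 < g (r *\<^sub>R x)" "0 < g (t *\<^sub>R y)" using g rt by auto
  have m: "0 < m" unfolding m_def using p \<alpha> k by (intro add_nonneg_pos) auto
  let ?S = "l1 * (l1 powr m * J1 * (l1 powr (1 / p - 1) * g (r *\<^sub>R x)) powr - \<alpha>) +
       l2 * (l2 powr m * J2 * (l2 powr (1 / p - 1) * g (t *\<^sub>R y)) powr - \<alpha>)"
  have "(J1 powr (- 1 / m) + J2 powr (- 1 / m)) powr (- m)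
    \<le> (l1 * (l1 powr (1 / p - 1) * g (r *\<^sub>R x)) + l2 * (l2 powr (1 / p - 1) * g (t *\<^sub>R y))) powr \<alpha> * ?S"
    using l l12 J m \<alpha> gpos by (intro transport_integrand_ge) auto
  also have "\<dots> \<le> g (u *\<^sub>R (x + y)) powr \<alpha> * ?S"
    using conc l gpos J \<alpha> by (intro mult_right_mono powr_mono2) auto
  also have "g (u *\<^sub>R (x + y)) powr \<alpha> = f (u *\<^sub>R (x + y))"
    using g xy by (simp add: u_def)
  also have "?S = u powr (k - 1) * u powr (1 + p) *
     (r powr (- p - 1) * (J1 / (g (r *\<^sub>R x) powr \<alpha> * r powr (k - 1)))) +
     u powr (k - 1) * u powr (1 + p) *
     (t powr (- p - 1) * (J2 / (g (t *\<^sub>R y) powr \<alpha> * t powr (k - 1))))"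
    unfolding l1_def l2_def m_def using p rt u gpos by (simp only: transported_term_eq)
  also have "\<dots> = u powr (k - 1) * u powr (1 + p) *
     (r powr (- p - 1) * (J1 / F x r) + t powr (- p - 1) * (J2 / F y t))"
    using rt by (simp only: F_def rpow_eq g(2) distrib_left)
  also have "f (u *\<^sub>R (x + y)) * \<dots> = F (x + y) u * (u powr (1 + p) *
     (r powr (- p - 1) * (J1 / F x r) + t powr (- p - 1) * (J2 / F y t)))"
    using u by (simp only: F_def rpow_eq mult.assoc)
  finally show ?thesis unfolding u_def .
qed

lemma ray_integral_sum_ge:
  fixes \<Omega> :: "'a set" and \<alpha> p J1 J2 :: real and x y :: 'a
  assumes p: "0 < p" "p \<le> 1" and \<alpha>: "0 < \<alpha>"
    and \<Omega>: "K \<subseteq> \<Omega>" "concave_on \<Omega> (\<lambda>z. f z powr (1 / \<alpha>))"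
    and mem: "\<And>r t. 0 < r \<Longrightarrow> 0 < t \<Longrightarrow> r *\<^sub>R x \<in> K \<Longrightarrow> t *\<^sub>R y \<in> K \<Longrightarrow> psum p r t *\<^sub>R (x + y) \<in> K"
    and nz: "x \<noteq> 0" "y \<noteq> 0" "x + y \<noteq> 0"
    and J: "ray_integral x = ennreal J1" "0 < J1" "ray_integral y = ennreal J2" "0 < J2"
  defines "m \<equiv> (1 / p - 1) * \<alpha> + k / p"
  shows "ennreal ((J1 powr (- 1 / m) + J2 powr (- 1 / m)) powr (- m)) \<le> ray_integral (x + y)"
proof -
  define F where "F = (\<lambda>z r. f (r *\<^sub>R z) * rpow r)"
  obtain R1 where R1: "0 \<le> R1" "\<And>r. 0 \<le> r \<Longrightarrow> r *\<^sub>R x \<in> K \<longleftrightarrow> r \<le> R1"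
    "continuous_on {0..R1} (F x)" "ray_integral x = ennreal (integral {0..R1} (F x))"
    unfolding F_def by (rule ray_integral_eq[OF nz(1)]) blast
  obtain R2 where R2: "0 \<le> R2" "\<And>r. 0 \<le> r \<Longrightarrow> r *\<^sub>R y \<in> K \<longleftrightarrow> r \<le> R2"
    "continuous_on {0..R2} (F y)" "ray_integral y = ennreal (integral {0..R2} (F y))"
    unfolding F_def by (rule ray_integral_eq[OF nz(2)]) blast
  obtain R where R: "0 \<le> R" "\<And>r. 0 \<le> r \<Longrightarrow> r *\<^sub>R (x + y) \<in> K \<longleftrightarrow> r \<le> R"
    "continuous_on {0..R} (F (x + y))" "ray_integral (x + y) = ennreal (integral {0..R} (F (x + y)))"
    unfolding F_def by (rule ray_integral_eq[OF nz(3)]) blast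
  have J': "integral {0..R1} (F x) = J1" "integral {0..R2} (F y) = J2"
  proof -
    \<comment> \<open>\<open>ennreal\<close> sends negative reals to 0, so cancelling it relies on
      the positive side.\<close>
    have *: "a = b" if "ennreal a = ennreal b" "0 < b" for a b
      using that by (cases "0 \<le> a") (auto simp: ennreal_neg)
    show "integral {0..R1} (F x) = J1" "integral {0..R2} (F y) = J2"
      using J R1(4) R2(4) by (auto intro: *)
  qed
  \<comment> \<open>A ray of length 0 would carry no mass.\<close>
  have Rpos: "0 < R1" "0 < R2"
    using J' J R1(1) R2(1) by (auto intro: le_neq_trans simp: less_le)
  have Fpos: "0 < F z r" if "0 < r" "r *\<^sub>R z \<in> K" for z r
    using pos[OF that(2)] that by (simp add: F_def rpow_eq)
  have "(J1 powr (- 1 / m) + J2 powr (- 1 / m)) powr (- m) \<le> integral {0..R} (F (x + y))"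
  proof (rule integral_ge_of_transport[OF p(1) Rpos(1) R1(3) _ Rpos(2) R2(3) _ _ R(3)])
    show "psum p R1 R2 \<le> R"
      using mem[of R1 R2] R1(2)[of R1] R2(2)[of R2] R(2)[of "psum p R1 R2"] Rpos psum_pos[of R1 p R2]
      by simp
    show "0 \<le> F (x + y) r" if "0 \<le> r" "r \<le> R" for r
      using that R(2)[of r] pos[of "r *\<^sub>R (x + y)"] by (simp add: F_def rpow_def)
    show "(J1 powr (- 1 / m) + J2 powr (- 1 / m)) powr (- m)
      \<le> F (x + y) (psum p r t) * (psum p r t powr (1 + p) *
        (r powr (- p - 1) * (integral {0..R1} (F x) / F x r)
          + t powr (- p - 1) * (integral {0..R2} (F y) / F y t)))"
      if "0 < r" "r \<le> R1" "0 < t" "t \<le> R2" for r t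
      unfolding m_def J' unfolding F_def
      using that R1(2)[of r] R2(2)[of t] mem[of r t] J
      by (intro transport_inequality[OF p \<alpha> \<Omega>]) auto
  qed (use Fpos R1(2) R2(2) in auto)
  then show ?thesis unfolding R(4) by (rule ennreal_leI)
qed

text \<open>Since \<open>q = k / m\<close>, the q-th power of the functional is the ray mass to the
  power \<open>- 1 / m\<close>, and the claim is \<open>ray_integral_sum_ge\<close>
  inverted.\<close>

lemma epowr_radial_functional_add_le:
  fixes \<Omega> :: "'a set" and \<alpha> p :: real and x y :: 'a
  assumes p: "0 < p" "p \<le> 1" and \<alpha>: "0 < \<alpha>"
    and \<Omega>: "K \<subseteq> \<Omega>" "concave_on \<Omega> (\<lambda>z. f z powr (1 / \<alpha>))"
    and mem: "\<And>r t. 0 < r \<Longrightarrow> 0 < t \<Longrightarrow> r *\<^sub>R x \<in> K \<Longrightarrow> t *\<^sub>R y \<in> K \<Longrightarrow> psum p r t *\<^sub>R (x + y) \<in> K"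
  defines "q \<equiv> inverse ((1 / p - 1) * \<alpha> * (1 / k) + 1 / p)"
  shows "epowr (radial_functional K f k (x + y)) q
    \<le> epowr (radial_functional K f k x) q + epowr (radial_functional K f k y) q"
proof -
  define m where "m = (1 / p - 1) * \<alpha> + k / p"
  have m: "0 < m" unfolding m_def using p \<alpha> k by (intro add_nonneg_pos) auto
  have "(1 / p - 1) * \<alpha> * (1 / k) + 1 / p = m / k"
    using k by (simp add: m_def add_divide_distrib)
  then have q: "q = k / m" by (simp add: q_def)
  then have q0: "0 < q" using k m by simp
  have "0 < k" using k by simp
  \<comment> \<open>A zero vector makes the claim immediate, and a ray without mass makes the right
    side infinite; the last case is the only substantial one.\<close>
  consider "x = 0" | "y = 0" | "x + y = 0" | "x \<noteq> 0" "ray_integral x = 0" | "y \<noteq> 0" "ray_integral y = 0"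
    | "x \<noteq> 0" "y \<noteq> 0" "x + y \<noteq> 0" "ray_integral x \<noteq> 0" "ray_integral y \<noteq> 0"
    by blast
  then show ?thesis
  proof cases
    case 6
    have fin: "\<exists>J. ray_integral z = ennreal J \<and> 0 < J" if "z \<noteq> 0" "ray_integral z \<noteq> 0" for z
    proof (rule ray_integral_eq[OF that(1)])
      fix R assume *: "ray_integral z = ennreal (integral {0..R} (\<lambda>r. f (r *\<^sub>R z) * rpow r))"
      then have "0 < integral {0..R} (\<lambda>r. f (r *\<^sub>R z) * rpow r)"
        using that(2) by (metis ennreal_neg not_less)
      then show ?thesis using * by blast
    qed
    obtain J1 where J1: "ray_integral x = ennreal J1" "0 < J1" using fin 6 by blast
    obtain J2 where J2: "ray_integral y = ennreal J2" "0 < J2" using fin 6 by blast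
    define S where "S = J1 powr (- 1 / m) + J2 powr (- 1 / m)"
    have S: "0 < S" using J1 J2 by (simp add: S_def add_pos_pos)
    have ge: "ennreal (S powr - m) \<le> ray_integral (x + y)"
      unfolding S_def m_def using 6 J1 J2 by (intro ray_integral_sum_ge[OF p \<alpha> \<Omega> mem]) auto
    obtain J where J: "ray_integral (x + y) = ennreal J" "0 < J"
    proof -
      have "ray_integral (x + y) \<noteq> 0" using ge S by auto
      then show thesis using fin 6 that by blast
    qed
    have \<Phi>: "epowr (radial_functional K f k z) q = ennreal (I powr (- 1 / m))"
      if "z \<noteq> 0" "ray_integral z = ennreal I" "0 < I" for z I
      using that \<open>0 < k\<close> by (simp add: radial_functional_eq epowr_ennreal powr_powr q)
    have "S powr - m \<le> J" using ge J by simp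
    then have "J powr (- 1 / m) \<le> (S powr - m) powr (- 1 / m)"
      using S m by (intro powr_mono2') auto
    also have "\<dots> = S" using S m by (simp add: powr_powr)
    finally have "ennreal (J powr (- 1 / m)) \<le> ennreal (J1 powr (- 1 / m)) + ennreal (J2 powr (- 1 / m))"
      by (simp add: S_def ennreal_leI flip: ennreal_plus)
    then show ?thesis using 6 J J1 J2 \<Phi> by simp
  next
    case 4
    then have "epowr (radial_functional K f k x) q = top"
      using q0 \<open>0 < k\<close> by (simp add: radial_functional_eq)
    then show ?thesis by simp
  next
    case 5
    then have "epowr (radial_functional K f k y) q = top"
      using q0 \<open>0 < k\<close> by (simp add: radial_functional_eq)
    then show ?thesis by simp
  qed (use q0 in \<open>auto simp: radial_functional_eq\<close>)
qed

end

text \<open>The p-triangle inequality, translated from gauges to radii through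
  \<open>minkowski_le_iff\<close>.\<close>

lemma p_convex_body_psum_mem:
  assumes K: "p_convex_body p K" and "0 < r" "0 < t" "r *\<^sub>R x \<in> K" "t *\<^sub>R y \<in> K"
  shows "psum p r t *\<^sub>R (x + y) \<in> K"
proof -
  have p: "0 < p" and star: "star_shaped K" and cl: "closed K"
    and tri: "epowr (minkowski K (x + y)) p \<le> epowr (minkowski K x) p + epowr (minkowski K y) p"
    using K by (auto simp: p_convex_body_def body_def compact_imp_closed)
  have le: "epowr (minkowski K z) p \<le> ennreal (a powr - p)" if "0 < a" "a *\<^sub>R z \<in> K" for a z
  proof -
    have "minkowski K z \<le> ennreal (1 / a)"
      using minkowski_le_iff[OF cl star, of "1 / a" z] that by simp
    then have "epowr (minkowski K z) p \<le> epowr (ennreal (1 / a)) p"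
      by (rule epowr_mono[OF p])
    also have "\<dots> = ennreal (a powr - p)"
      using that by (simp add: epowr_ennreal powr_divide powr_minus_divide)
    finally show ?thesis .
  qed
  define u where "u = psum p r t"
  have u: "0 < u" unfolding u_def using assms by (intro psum_pos)
  have "epowr (minkowski K (x + y)) p \<le> ennreal (r powr - p) + ennreal (t powr - p)"
    using tri le[of r x] le[of t y] assms by (meson add_mono order_trans)
  also have "\<dots> = ennreal (u powr - p)"
    using assms p by (simp add: u_def psum_powr flip: ennreal_plus)
  also have "u powr - p = (1 / u) powr p"
    using u by (simp add: powr_divide powr_minus_divide)
  finally have "minkowski K (x + y) \<le> ennreal (1 / u)"
    by (rule epowr_le_imp_le[OF p, rotated]) (use u in simp)
  then show ?thesis
    using minkowski_le_iff[OF cl star, of "1 / u" "x + y"] u by (simp add: u_def)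
qed

text \<open>A closed star-shaped set is the unit sublevel set of its gauge. This gives the
  uniqueness of \<open>L\<close>.\<close>

lemma minkowski_inject:
  assumes "closed K" "star_shaped K" "closed L" "star_shaped L" "\<And>x. minkowski K x = minkowski L x"
  shows "K = L"
  using minkowski_le_iff[of K 1] minkowski_le_iff[of L 1] assms by auto

theorem theorem9:
  fixes \<Omega> K :: "'a::euclidean_space set" and \<mu> :: "'a measure" and f :: "'a \<Rightarrow> real"
    and s p k :: real
  assumes "open \<Omega>" and "convex \<Omega>"
    and "0 < s" and "s < 1 / real DIM('a)"
    and "s_concave_measure s \<Omega> \<mu>" and "borell_density s \<Omega> \<mu> f"
    and "0 < p" and "p \<le> 1" and "p_convex_body p K" and "K \<subseteq> \<Omega>"
    and "1 \<le> k"
  shows "\<exists>!L. (\<forall>x. minkowski L x = radial_functional K f k x) \<and>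
           p_convex_body (inverse ((1 / p - 1) * (1 / s - real DIM('a)) * (1 / k) + 1 / p)) L"
proof -
  define \<alpha> where "\<alpha> = 1 / s - real DIM('a)"
  define q where "q = inverse ((1 / p - 1) * \<alpha> * (1 / k) + 1 / p)"
  have \<alpha>: "0 < \<alpha>" "1 / \<alpha> = s / (1 - real DIM('a) * s)"
    using assms(3,4) by (auto simp: \<alpha>_def field_simps)
  \<comment> \<open>These bounds give 1/q \<ge> 1, so \<open>q\<close> is an admissible exponent for
    \<open>p_convex_body\<close>.\<close>
  have "0 \<le> (1 / p - 1) * \<alpha> * (1 / k)" "1 \<le> 1 / p"
    using assms(7,8,11) \<alpha> by auto
  then have q: "0 < q" "q \<le> 1"
    by (auto simp: q_def inverse_le_1_iff)
  have K: "compact K" "star_shaped K" "interior K \<noteq> {}"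
    using assms(9) by (auto simp: p_convex_body_def body_def)
  interpret star_body_density K f k
  proof
    show "continuous_on K f"
      using borell_density_continuous[OF assms(1,3,4,6)] assms(10) by (rule continuous_on_subset)
    show "0 < f x" if "x \<in> K" for x
      using borell_density_pos[OF assms(1,6)] assms(10) that by blast
  qed (use K assms(11) in auto)
  have conc: "concave_on \<Omega> (\<lambda>z. f z powr (1 / \<alpha>))"
    using assms(6) by (simp add: borell_density_def \<alpha>(2))
  have "epowr (radial_functional K f k (x + y)) q
    \<le> epowr (radial_functional K f k x) q + epowr (radial_functional K f k y) q" for x y
    unfolding q_def
    by (rule epowr_radial_functional_add_le[OF assms(7,8) \<alpha>(1) assms(10) conc])
      (rule p_convex_body_psum_mem[OF assms(9)])
  then have "p_convex_body q radial_body"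
    using q compact_radial_body interior_radial_body star_shaped_radial_body by (simp add: p_convex_body_def body_def minkowski_radial_body)
  then show ?thesis
    unfolding \<alpha>_def[symmetric] q_def[symmetric]
  proof (intro ex1I[of _ radial_body] conjI allI minkowski_radial_body)
    fix L' assume L': "(\<forall>x. minkowski L' x = radial_functional K f k x) \<and> p_convex_body q L'"
    then show "L' = radial_body"
      using closed_radial_body star_shaped_radial_body
      by (intro minkowski_inject) (auto simp: p_convex_body_def body_def minkowski_radial_body compact_imp_closed)
  qed
qed

end
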